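(* Let $M,K,(D_{ij})_{i,j=1}^q,(R_{ij})_{i,j=1}^q$ be as in the context, with the eigenvalues of $P=M^{-1/2}KM^{-1/2}$ pairwise distinct and not all $R_{ij}$ equal to zero. Suppose $\operatorname{Re}\lambda_2(G_{kk}+\mathrm{j}B_{kk})>0$ for all $k=1,\dots,n$. Then there exists $r>0$ such that the array $$M\ddot x_i+Kx_i+\sum_{j=1}^q D_{ij}(\dot x_i-\dot x_j)+\varepsilon\sum_{j=1}^q R_{ij}(x_i-x_j)=0,\qquad i=1,\dots,q,$$ synchronizes for all $\varepsilon\in(0,r)$. In particular, one can choose $$r=\frac{\bar\gamma\,\bar\sigma\,\bar\mu}{\left(\sqrt{\|G\|}+2\bar\gamma\right)\sqrt{n-1}\,\|B\|\,(\bar\mu+\|B\|)}.$$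
   Context: Let $n$ and $q$ be the positive integers giving, respectively, the dimension of each $x_i$ and the number of oscillators; $\mathrm{j}$ denotes the imaginary unit, $\otimes$ the Kronecker product, $I_q$ the $q\times q$ identity matrix, $\|\cdot\|$ the Euclidean norm of vectors and the induced 2-norm of matrices, $^*$ the conjugate transpose, and $\mathbf{1}_q=[1\ 1\ \cdots\ 1]^T/\sqrt q\in\mathbb{R}^q$. $M,K\in\mathbb{R}^{n\times n}$ are symmetric positive definite. For $i,j\in\{1,\dots,q\}$ the matrices $D_{ij},R_{ij}\in\mathbb{R}^{n\times n}$ are symmetric positive semidefinite with $D_{ij}=D_{ji}$, $R_{ij}=R_{ji}$, $D_{ii}=0$, $R_{ii}=0$, and $R_{ij}\neq 0$ for at least one pair $(i,j)$. The unknowns are $x_i(t)\in\mathbb{R}^n$. Put $P:=M^{-1/2}KM^{-1/2}$; its eigenvalues $\sigma_1,\dots,\sigma_n>0$ are assumed pairwise distinct, with corresponding real unit eigenvectors $v_1,\dots,v_n\in\mathbb{R}^n$. The array (for a given coupling strength $\varepsilon>0$) synchronizes if $\|x_i(t)-x_j(t)\|\to 0$ as $t\to\infty$ for all indices $i,j$ and all initial conditions. For symmetric positive semidefinite real $n\times n$ matrices $W_{ij}=W_{ji}$ with $W_{ii}=0$, $\mathrm{lap}(W_{ij})_{i,j=1}^q$ denotes the $qn\times qn$ block matrix whose $(i,i)$ block is $\sum_j W_{ij}$ and whose $(i,j)$ block, $i\ne j$, is $-W_{ij}$. Set $L_{\mathrm d}:=\mathrm{lap}(M^{-1/2}D_{ij}M^{-1/2})_{i,j=1}^q$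 and $L_{\mathrm r}:=\mathrm{lap}(M^{-1/2}R_{ij}M^{-1/2})_{i,j=1}^q$. For $k,\ell=1,\dots,n$ let $G_{k\ell}=[I_q\otimes v_k^T]L_{\mathrm d}[I_q\otimes v_\ell]\in\mathbb{R}^{q\times q}$ and $B_{k\ell}=[I_q\otimes v_k^T]L_{\mathrm r}[I_q\otimes v_\ell]\in\mathbb{R}^{q\times q}$, and let $G,B\in\mathbb{R}^{qn\times qn}$ be the block matrices with $(k,\ell)$ blocks $G_{k\ell}$, $B_{k\ell}$ respectively. For a square complex matrix $X$, $\lambda_k(X)$ denotes the $k$th smallest eigenvalue with respect to the real part, counted with algebraic multiplicity: $\operatorname{Re}\lambda_1(X)\le\operatorname{Re}\lambda_2(X)\le\cdots$. Define the positive numbers $$\bar\sigma:=\tfrac12\min_{k\ne\ell}|\sigma_k-\sigma_\ell|,\qquad \bar\mu:=\tfrac12\min_k\left(\min_{\lambda_i(B_{kk})\ne\lambda_j(B_{kk})}|\lambda_i(B_{kk})-\lambda_j(B_{kk})|\right).$$ For $k=1,\dots,n$ let $$\mathcal{C}_k:=\{w\in\mathbb{C}^q:\ \|w\|=1,\ (B_{kk}-\mu I_q)w=0\text{ for some }\mu\in\mathbb{R},\ \mathbf{1}_q^Tw=0\},$$ a nonempty compact set, and define the nonnegative real number $$\bar\gamma:=\left[\min_k\left(\min_{w\in\mathcal{C}_k}w^*G_{kk}w\right)\right]^{1/2}.$$ *)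

theory Defs
  imports
    "HOL-Analysis.Analysis"
    "HOL-Computational_Algebra.Computational_Algebra"
begin

definition sym_psd :: "real^'n^'n \<Rightarrow> bool" where
  "sym_psd A \<longleftrightarrow> transpose A = A \<and> (\<forall>x. 0 \<le> x \<bullet> (A *v x))"

definition sym_pd :: "real^'n^'n \<Rightarrow> bool" where
  "sym_pd A \<longleftrightarrow> transpose A = A \<and> (\<forall>x. x \<noteq> 0 \<longrightarrow> 0 < x \<bullet> (A *v x))"

(* The principal square root: for symmetric positive semidefinite A it is the unique
   symmetric positive semidefinite S with S ** S = A. *)
definition matrix_sqrt :: "real^'n^'n \<Rightarrow> real^'n^'n" where
  "matrix_sqrt A = (THE S. sym_psd S \<and> S ** S = A)"

definition inv_sqrt :: "real^'n^'n \<Rightarrow> real^'n^'n" where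
  "inv_sqrt A = matrix_inv (matrix_sqrt A)"

definition matrix_norm :: "real^'a^'b \<Rightarrow> real" where
  "matrix_norm A = onorm (\<lambda>x. A *v x)"


(* The type 'q indexes the oscillators and 'n the coordinates of each x i.  A vector of
   length qn in block form is indexed by pairs, the first component naming the block. *)

definition array_solution ::
  "real^'n^'n \<Rightarrow> real^'n^'n \<Rightarrow> ('q::finite \<Rightarrow> 'q \<Rightarrow> real^'n^'n) \<Rightarrow> ('q \<Rightarrow> 'q \<Rightarrow> real^'n^'n) \<Rightarrow>
   real \<Rightarrow> ('q \<Rightarrow> real \<Rightarrow> real^'n) \<Rightarrow> bool" where
  "array_solution M K D R \<epsilon> x \<longleftrightarrow>
     (\<exists>x' x''. \<forall>i. \<forall>t\<ge>0.
        (x i has_vector_derivative x' i t) (at t within {0..}) \<and>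
        (x' i has_vector_derivative x'' i t) (at t within {0..}) \<and>
        M *v x'' i t + K *v x i t + (\<Sum>j\<in>UNIV. D i j *v (x' i t - x' j t))
          + \<epsilon> *\<^sub>R (\<Sum>j\<in>UNIV. R i j *v (x i t - x j t)) = 0)"

definition synchronizes ::
  "real^'n^'n \<Rightarrow> real^'n^'n \<Rightarrow> ('q::finite \<Rightarrow> 'q \<Rightarrow> real^'n^'n) \<Rightarrow> ('q \<Rightarrow> 'q \<Rightarrow> real^'n^'n) \<Rightarrow>
   real \<Rightarrow> bool" where
  "synchronizes M K D R \<epsilon> \<longleftrightarrow>
     (\<forall>x. array_solution M K D R \<epsilon> x \<longrightarrow>
        (\<forall>i j. ((\<lambda>t. norm (x i t - x j t)) \<longlongrightarrow> 0) at_top))"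


definition lap :: "('q::finite \<Rightarrow> 'q \<Rightarrow> real^'n^'n) \<Rightarrow> real^('q \<times> 'n)^('q \<times> 'n)" where
  "lap W = (\<chi> a b. if fst a = fst b then (\<Sum>j\<in>UNIV. W (fst a) j) $ snd a $ snd b
                   else - W (fst a) (fst b) $ snd a $ snd b)"

(* Kronecker products of a matrix with a column vector v and with a row vector v^T; the
   resulting index over a one-element second factor is dropped. *)
definition kron_col :: "real^'b^'a \<Rightarrow> real^'n \<Rightarrow> real^'b^('a \<times> 'n)" where
  "kron_col A v = (\<chi> a j. A $ fst a $ j * v $ snd a)"

definition kron_row :: "real^'b^'a \<Rightarrow> real^'n \<Rightarrow> real^('b \<times> 'n)^'a" where
  "kron_row A v = (\<chi> i b. A $ i $ fst b * v $ snd b)"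

definition modal_block ::
  "real^('q::finite \<times> 'n)^('q \<times> 'n) \<Rightarrow> ('n \<Rightarrow> real^'n) \<Rightarrow> 'n \<Rightarrow> 'n \<Rightarrow> real^'q^'q" where
  "modal_block L v k l = kron_row (mat 1) (v k) ** L ** kron_col (mat 1) (v l)"

definition block_matrix :: "('n::finite \<Rightarrow> 'n \<Rightarrow> real^'q^'q) \<Rightarrow> real^('n \<times> 'q)^('n \<times> 'q)" where
  "block_matrix X = (\<chi> a b. X (fst a) (fst b) $ snd a $ snd b)"


definition char_polynomial :: "complex^'a^'a \<Rightarrow> complex poly" where
  "char_polynomial X = det (\<chi> i j. (if i = j then [:0, 1:] else 0) - [:X $ i $ j:])"

(* Eigenvalues repeated according to algebraic multiplicity and sorted by real part; the
   order among eigenvalues with equal real part is unspecified. *)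
definition eigenvalue_list :: "complex^'a^'a \<Rightarrow> complex list" where
  "eigenvalue_list X = sort_key Re (SOME xs. mset xs = proots (char_polynomial X))"

(* Numbered from k = 1 to the dimension; list indices start at 0. *)
definition eigenval :: "nat \<Rightarrow> complex^'a^'a \<Rightarrow> complex" where
  "eigenval k X = eigenvalue_list X ! (k - 1)"

definition cmat :: "real^'a^'b \<Rightarrow> complex^'a^'b" where
  "cmat A = (\<chi> i j. complex_of_real (A $ i $ j))"

definition complex_matrix :: "real^'a^'b \<Rightarrow> real^'a^'b \<Rightarrow> complex^'a^'b" where
  "complex_matrix A B = (\<chi> i j. complex_of_real (A $ i $ j) + \<i> * complex_of_real (B $ i $ j))"


definition sigma_bar :: "('n::finite \<Rightarrow> real) \<Rightarrow> real" where
  "sigma_bar \<sigma> = 1/2 * Min {\<bar>\<sigma> k - \<sigma> l\<bar> | k l. k \<noteq> l}"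

(* The nested minimum over k and then over pairs of distinct eigenvalues is written as one
   minimum over the union: an index k whose matrix has a single eigenvalue (this happens for
   the zero matrix) contributes nothing, i.e. its inner minimum counts as infinite. *)
definition mu_bar :: "('n::finite \<Rightarrow> real^'q^'q) \<Rightarrow> real" where
  "mu_bar B = 1/2 * Min (\<Union>k. {cmod (eigenval i (cmat (B k)) - eigenval j (cmat (B k))) | i j.
      i \<in> {1..CARD('q)} \<and> j \<in> {1..CARD('q)} \<and>
      eigenval i (cmat (B k)) \<noteq> eigenval j (cmat (B k))})"

definition unit_ones :: "real^'q" where
  "unit_ones = (\<chi> i. 1 / sqrt (real CARD('q)))"

definition C_set :: "real^'q^'q \<Rightarrow> (complex^'q) set" where
  "C_set B = {w. norm w = 1 \<and>
      (\<exists>\<mu>::real. (cmat B - mat (complex_of_real \<mu>)) *v w = 0) \<and>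
      (\<Sum>i\<in>UNIV. complex_of_real (unit_ones $ i) * w $ i) = 0}"

(* w* A w, a real number for real symmetric A *)
definition hermitian_form :: "real^'q^'q \<Rightarrow> complex^'q \<Rightarrow> real" where
  "hermitian_form A w = Re (\<Sum>i\<in>UNIV. cnj (w $ i) * (cmat A *v w) $ i)"

(* The infimum is attained: C_set is compact, and nonempty when B is symmetric with
   unit_ones in its kernel and CARD('q) is at least 2. *)
definition gamma_bar :: "('n::finite \<Rightarrow> real^'q^'q) \<Rightarrow> ('n \<Rightarrow> real^'q^'q) \<Rightarrow> real" where
  "gamma_bar G B = sqrt (Min (range (\<lambda>k. INF w\<in>C_set (B k). hermitian_form (G k) w)))"

end

theory Submission
  imports Defs
begin

text \<open>
  Let \<open>M = S\<^sup>2\<close> with \<open>S\<close> positive definite. In the variables \<open>y\<^sub>i = S x\<^sub>i\<close>, expanded in the orthonormal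
  eigenvectors \<open>v\<^sub>k\<close> of \<open>P\<close>, the array becomes
  \<open>z'' + G z' + Q z = 0\<close> with \<open>Q = \<Sigma> + \<epsilon> B\<close> and \<open>\<Sigma>\<close> the diagonal matrix of the \<open>\<sigma>\<^sub>k\<close>. Here \<open>G\<close> is
  positive semidefinite, \<open>Q\<close> is positive definite, and both preserve the states whose blocks have
  average zero over the oscillators.

  The energy of such a system decreases at the rate \<open>2 z' \<bullet> G z'\<close>, and LaSalle's argument shows that
  the average-free part of \<open>z\<close> tends to zero unless it supports an undamped mode: a nonzero
  average-free \<open>w\<close> with \<open>G w = 0\<close> and \<open>Q w = \<theta> w\<close> (\<open>damped_solution_decay\<close>,
  \<open>synchronizes_if_no_undamped_mode\<close>).

  Undamped modes are excluded by perturbation theory (\<open>undamped_mode_vanishes\<close>). For small \<open>\<epsilon>\<close> the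
  eigenvector \<open>w\<close> is concentrated in one block \<open>m\<close>, since the \<open>\<sigma>\<^sub>k\<close> are separated, and within that
  block near one eigenspace of \<open>B\<^sub>m\<^sub>m\<close>, since the distinct eigenvalues of \<open>B\<^sub>m\<^sub>m\<close> are separated. On
  the average-free vectors of that eigenspace the form of \<open>G\<^sub>m\<^sub>m\<close> is at least \<open>\<gamma>\<^sup>2\<close> times the squared
  norm, which contradicts \<open>G w = 0\<close> once the errors are small; comparing the two sides gives the
  explicit bound on \<open>\<epsilon>\<close>.

  The spectral hypothesis makes \<open>\<gamma>\<close> positive (\<open>gamma_bar_pos\<close>): an eigenvector of
  \<open>B\<^sub>k\<^sub>k\<close> in the kernel of \<open>G\<^sub>k\<^sub>k\<close> and orthogonal to the all-ones vector would be a second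
  eigenvector of \<open>G\<^sub>k\<^sub>k + \<i> B\<^sub>k\<^sub>k\<close> on the imaginary axis, besides the all-ones vector itself.
\<close>

\<comment> \<open>So that \<open>$\<close> denotes vector components only, not also coefficients of formal power series.\<close>
no_notation fps_nth (infixl "$" 75)

section \<open>Self-adjoint operators and square roots\<close>

definition selfadjoint :: "('a::real_inner \<Rightarrow> 'a) \<Rightarrow> bool" where
  "selfadjoint f \<longleftrightarrow> linear f \<and> (\<forall>x y. f x \<bullet> y = x \<bullet> f y)"

lemma selfadjoint_linear: "selfadjoint f \<Longrightarrow> linear f"
  and selfadjoint_inner: "selfadjoint f \<Longrightarrow> f x \<bullet> y = x \<bullet> f y"
  unfolding selfadjoint_def by blast+

text \<open>If \<open>g = f x\<close> were nonzero, the quadratic form would be negative at \<open>x - t g\<close> for small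
  \<open>t > 0\<close>: it equals \<open>- 2 t \<bar>g\<bar>\<^sup>2 + O(t\<^sup>2)\<close> there. The restriction to an invariant subspace is
  what allows this fact to produce eigenvectors inside a subspace.\<close>

lemma selfadjoint_psd_kernel:
  fixes f :: "'a::real_inner \<Rightarrow> 'a"
  assumes f: "selfadjoint f" and W: "subspace W" "\<And>x. x \<in> W \<Longrightarrow> f x \<in> W"
    and psd: "\<And>x. x \<in> W \<Longrightarrow> 0 \<le> x \<bullet> f x"
    and x: "x \<in> W" "x \<bullet> f x = 0"
  shows "f x = 0"
proof (rule ccontr)
  assume nz: "f x \<noteq> 0"
  interpret f: linear f by (rule selfadjoint_linear[OF f])
  define g where "g = f x"
  have gW: "g \<in> W" unfolding g_def by (rule W(2)[OF x(1)])
  define c where "c = g \<bullet> f g"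
  have c0: "c \<ge> 0" unfolding c_def by (rule psd[OF gW])
  have gg: "g \<bullet> g > 0" using nz by (simp add: g_def)
  have key: "2 * t * (g \<bullet> g) \<le> t\<^sup>2 * c" for t
  proof -
    have "x - t *\<^sub>R g \<in> W"
      using x(1) gW W(1) by (simp add: subspace_diff subspace_scale)
    from psd[OF this] have "0 \<le> (x - t *\<^sub>R g) \<bullet> (f x - t *\<^sub>R f g)"
      by (simp add: f.diff f.scaleR)
    also have "\<dots> = x \<bullet> f x - t * (x \<bullet> f g) - t * (g \<bullet> f x) + t\<^sup>2 * (g \<bullet> f g)"
      by (simp add: inner_diff_left inner_diff_right power2_eq_square algebra_simps)
    also have "x \<bullet> f g = g \<bullet> g"
      using selfadjoint_inner[OF f, of x g] by (simp add: g_def)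
    finally show ?thesis using x(2) by (simp add: c_def g_def)
  qed
  define t where "t = (g \<bullet> g) / (c + 1)"
  have t: "t > 0" unfolding t_def using gg c0 by simp
  have "2 * (g \<bullet> g) \<le> t * c"
    using key[of t] t by (simp add: power2_eq_square)
  also have "\<dots> \<le> g \<bullet> g"
    unfolding t_def using gg c0 by (simp add: field_simps)
  finally show False using gg by simp
qed

text \<open>The Rayleigh quotient attains its maximum \<open>\<kappa>\<close> over the unit sphere of the subspace. There
  \<open>\<kappa> - f\<close> is positive semidefinite and its form vanishes at the maximiser, so the maximiser
  lies in its kernel.\<close>

lemma selfadjoint_eigenvector_in_subspace:
  fixes f :: "'a::euclidean_space \<Rightarrow> 'a"
  assumes f: "selfadjoint f" and W: "subspace W" "\<And>x. x \<in> W \<Longrightarrow> f x \<in> W"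
    and nz: "W \<noteq> {0}"
  obtains x \<kappa> where "x \<in> W" "norm x = 1" "f x = \<kappa> *\<^sub>R x"
proof -
  interpret f: linear f by (rule selfadjoint_linear[OF f])
  define S where "S = W \<inter> sphere 0 1"
  have "compact S" unfolding S_def
    by (rule closed_Int_compact) (auto simp: closed_subspace W)
  moreover have "S \<noteq> {}"
  proof -
    obtain y where y: "y \<in> W" "y \<noteq> 0" using nz subspace_0[OF W(1)] by auto
    have "y /\<^sub>R norm y \<in> S" using y W(1) by (simp add: S_def subspace_scale)
    thus ?thesis by auto
  qed
  moreover have "continuous_on S (\<lambda>x. x \<bullet> f x)"
    by (intro continuous_on_inner continuous_on_id linear_continuous_on)
       (simp add: f.linear_axioms flip: linear_conv_bounded_linear)
  ultimately obtain x where x: "x \<in> S" and max: "\<And>y. y \<in> S \<Longrightarrow> y \<bullet> f y \<le> x \<bullet> f x"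
    using continuous_attains_sup by metis
  define \<kappa> where "\<kappa> = x \<bullet> f x"
  define h where "h y = \<kappa> *\<^sub>R y - f y" for y
  have xW: "x \<in> W" and x1: "norm x = 1" using x by (auto simp: S_def)
  have "h x = 0"
  proof (rule selfadjoint_psd_kernel[OF _ W(1) _ _ xW])
    show "selfadjoint h" unfolding selfadjoint_def h_def
      by (auto intro!: linearI simp: f.add f.scaleR algebra_simps inner_diff_left inner_diff_right
          selfadjoint_inner[OF f])
    show "h y \<in> W" if "y \<in> W" for y
      using that W by (simp add: h_def subspace_diff subspace_scale)
    show "0 \<le> y \<bullet> h y" if "y \<in> W" for y
    proof (cases "y = 0")
      case False
      have "y /\<^sub>R norm y \<in> S" using that False W(1) by (simp add: S_def subspace_scale)
      from max[OF this] have "(y \<bullet> f y) / (norm y)\<^sup>2 \<le> \<kappa>"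
        by (simp add: f.scaleR \<kappa>_def power2_eq_square divide_inverse mult_ac)
      hence "y \<bullet> f y \<le> \<kappa> * (norm y)\<^sup>2" using False by (simp add: pos_divide_le_eq)
      thus ?thesis by (simp add: h_def inner_diff_right power2_norm_eq_inner)
    qed simp
    show "x \<bullet> h x = 0"
      using x1 by (simp add: h_def inner_diff_right \<kappa>_def dot_square_norm)
  qed
  thus ?thesis using that[of x \<kappa>] xW x1 by (simp add: h_def)
qed

definition eigenbasis :: "('a::euclidean_space \<Rightarrow> 'a) \<Rightarrow> ('a \<Rightarrow> real) \<Rightarrow> 'a set \<Rightarrow> bool" where
  "eigenbasis f \<kappa> S \<longleftrightarrow> finite S \<and> pairwise orthogonal S \<and> (\<forall>b\<in>S. norm b = 1) \<and> span S = UNIV \<and>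
     (\<forall>b\<in>S. f b = \<kappa> b *\<^sub>R b)"

text \<open>Take an orthonormal set of eigenvectors of maximal cardinality. Its orthogonal complement is
  invariant, so a nonzero complement would contain one more eigenvector.\<close>

theorem selfadjoint_eigenbasis:
  fixes f :: "'a::euclidean_space \<Rightarrow> 'a"
  assumes f: "selfadjoint f"
  obtains S \<kappa> where "eigenbasis f \<kappa> S"
proof -
  define ok where "ok S \<longleftrightarrow> pairwise orthogonal S \<and> (\<forall>b\<in>S. norm b = 1 \<and> (\<exists>l. f b = l *\<^sub>R b))"
    for S :: "'a set"
  have ind: "independent S" if "ok S" for S
    using that unfolding ok_def by (intro pairwise_orthogonal_independent) auto
  have bd: "card S \<le> DIM('a)" if "ok S" for S
    using independent_bound[OF ind[OF that]] by simp
  have "ok {}" by (simp add: ok_def)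
  then obtain S where S: "ok S" and max: "\<And>T. ok T \<Longrightarrow> card T \<le> card S"
    using ex_has_greatest_nat[of ok "{}" card "Suc DIM('a)"] bd by (auto simp: less_Suc_eq_le)
  have fin: "finite S" using independent_bound[OF ind[OF S]] by simp
  define W where "W = {x. \<forall>b\<in>S. orthogonal b x}"
  have W: "subspace W" unfolding W_def
    by (auto simp: subspace_def orthogonal_def inner_add_right)
  have fW: "f x \<in> W" if "x \<in> W" for x
    unfolding W_def
  proof safe
    fix b assume b: "b \<in> S"
    then obtain l where l: "f b = l *\<^sub>R b" using S by (auto simp: ok_def)
    have "b \<bullet> f x = f b \<bullet> x" by (simp add: selfadjoint_inner[OF f])
    thus "orthogonal b (f x)" using b that l by (simp add: W_def orthogonal_def)
  qed
  have "W = {0}"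
  proof (rule ccontr)
    assume "W \<noteq> {0}"
    from selfadjoint_eigenvector_in_subspace[OF f W fW this]
    obtain x l where x: "x \<in> W" "norm x = 1" "f x = l *\<^sub>R x" by metis
    have "ok (insert x S)"
      using x S unfolding ok_def W_def
      by (auto simp: pairwise_insert orthogonal_commute)
    from max[OF this] have "x \<in> S" using fin by (auto simp: card_insert_if split: if_splits)
    with x have "orthogonal x x" by (auto simp: W_def)
    with x(2) show False by (simp add: orthogonal_def)
  qed
  have "span S = UNIV"
  proof (rule ccontr)
    assume "span S \<noteq> UNIV"
    then obtain a where a: "a \<noteq> 0" "\<And>x. x \<in> span S \<Longrightarrow> orthogonal a x"
      using orthogonal_to_subspace_exists_gen[of S UNIV] by (auto simp: psubset_eq)
    hence "a \<in> W" by (auto simp: W_def orthogonal_commute span_base)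
    with \<open>W = {0}\<close> a(1) show False by simp
  qed
  moreover have "\<exists>\<kappa>. \<forall>b\<in>S. f b = \<kappa> b *\<^sub>R b"
    using S unfolding ok_def by metis
  ultimately show ?thesis using that S fin unfolding eigenbasis_def ok_def by metis
qed

lemma eigenbasis_expansion:
  assumes "eigenbasis f \<kappa> S"
  shows "(\<Sum>b\<in>S. (x \<bullet> b) *\<^sub>R b) = x"
proof -
  define d where "d = x - (\<Sum>b\<in>S. (x \<bullet> b) *\<^sub>R b)"
  have S: "finite S" "span S = UNIV" "\<And>b. b \<in> S \<Longrightarrow> b \<bullet> b = 1"
    "\<And>b c. b \<in> S \<Longrightarrow> c \<in> S \<Longrightarrow> b \<noteq> c \<Longrightarrow> b \<bullet> c = 0"
    using assms by (auto simp: eigenbasis_def pairwise_def orthogonal_def dot_square_norm)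
  have ortho: "d \<bullet> c = 0" if c: "c \<in> S" for c
  proof -
    have "(\<Sum>b\<in>S. (x \<bullet> b) *\<^sub>R b) \<bullet> c = (\<Sum>b\<in>S. if b = c then x \<bullet> c else 0)"
      unfolding inner_sum_left by (rule sum.cong) (use S c in auto)
    thus ?thesis using c S(1) by (simp add: d_def inner_diff_left)
  qed
  have "orthogonal d y" if "y \<in> span S" for y
    by (rule orthogonal_to_span[OF that]) (simp add: orthogonal_def ortho)
  hence "d \<bullet> d = 0" using S(2) by (auto simp: orthogonal_def)
  thus ?thesis by (simp add: d_def)
qed

lemma eigenbasis_apply:
  assumes "eigenbasis f \<kappa> S" "linear f"
  shows "f x = (\<Sum>b\<in>S. (\<kappa> b * (x \<bullet> b)) *\<^sub>R b)"
proof -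
  have "f x = f (\<Sum>b\<in>S. (x \<bullet> b) *\<^sub>R b)" by (simp add: eigenbasis_expansion[OF assms(1)])
  also have "\<dots> = (\<Sum>b\<in>S. (x \<bullet> b) *\<^sub>R f b)"
    by (simp add: linear_sum[OF assms(2)] linear_scale[OF assms(2)])
  also have "\<dots> = (\<Sum>b\<in>S. (\<kappa> b * (x \<bullet> b)) *\<^sub>R b)"
    using assms(1) by (intro sum.cong) (auto simp: eigenbasis_def mult.commute)
  finally show ?thesis .
qed

lemma eigenbasis_norm_sum:
  assumes "eigenbasis f \<kappa> S" "T \<subseteq> S"
  shows "(norm (\<Sum>b\<in>T. c b *\<^sub>R b))\<^sup>2 = (\<Sum>b\<in>T. (c b)\<^sup>2)"
proof -
  have T: "finite T" "pairwise orthogonal T" "\<And>b. b \<in> T \<Longrightarrow> norm b = 1"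
    using assms finite_subset[OF assms(2)] pairwise_subset[OF _ assms(2)]
    by (auto simp: eigenbasis_def)
  have "(norm (\<Sum>b\<in>T. c b *\<^sub>R b))\<^sup>2 = (\<Sum>b\<in>T. (norm (c b *\<^sub>R b))\<^sup>2)"
    by (rule norm_sum_Pythagorean[OF T(1)])
       (use T(2) in \<open>auto simp: pairwise_def orthogonal_def\<close>)
  thus ?thesis using T(3) by simp
qed

text \<open>At most one eigenvalue \<open>\<kappa>\<close> of \<open>f\<close> lies within \<open>\<mu>\<close> of \<open>\<nu>\<close>, because distinct eigenvalues are
  \<open>2 \<mu>\<close> apart. Let \<open>u0\<close> be the part of \<open>u\<close> in that eigenspace: on the remaining eigenvectors
  \<open>f - \<nu>\<close> stretches by at least \<open>\<mu>\<close>, so a vector that almost satisfies the eigenvector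
  equation is close to a true eigenvector.\<close>

lemma approximate_eigenvector:
  fixes f :: "'a::euclidean_space \<Rightarrow> 'a"
  assumes f: "selfadjoint f" and \<mu>: "\<mu> > 0"
    and gap: "\<And>\<alpha> \<beta> x y. \<lbrakk>x \<noteq> 0; y \<noteq> 0; f x = \<alpha> *\<^sub>R x; f y = \<beta> *\<^sub>R y; \<alpha> \<noteq> \<beta>\<rbrakk> \<Longrightarrow> 2 * \<mu> \<le> \<bar>\<alpha> - \<beta>\<bar>"
  obtains u0 u1 \<kappa> where "u = u0 + u1" "f u0 = \<kappa> *\<^sub>R u0"
    "\<mu> * norm u1 \<le> norm (f u - \<nu> *\<^sub>R u)" "\<And>x. f x = \<kappa> *\<^sub>R x \<Longrightarrow> u1 \<bullet> x = 0"
proof -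
  have lin: "linear f" by (rule selfadjoint_linear[OF f])
  obtain S ev where S: "eigenbasis f ev S" by (rule selfadjoint_eigenbasis[OF f])
  have Sb: "finite S" "\<And>b. b \<in> S \<Longrightarrow> b \<noteq> 0" "\<And>b. b \<in> S \<Longrightarrow> f b = ev b *\<^sub>R b"
    using S by (auto simp: eigenbasis_def)
  define near where "near = {b \<in> S. \<bar>ev b - \<nu>\<bar> < \<mu>}"
  define far where "far = S - near"
  obtain \<kappa> where \<kappa>: "\<bar>\<kappa> - \<nu>\<bar> < \<mu>" "\<And>b. b \<in> near \<Longrightarrow> ev b = \<kappa>"
  proof (cases "near = {}")
    case True
    \<comment> \<open>Then \<open>\<nu>\<close> is not an eigenvalue, so \<open>u0 = 0\<close> may serve as an element of its trivial eigenspace.\<close>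
    show ?thesis by (rule that[of \<nu>]) (use True \<mu> in auto)
  next
    case False
    then obtain a where a: "a \<in> near" by blast
    have "ev b = ev a" if "b \<in> near" for b
    proof (rule ccontr)
      assume "ev b \<noteq> ev a"
      hence "2 * \<mu> \<le> \<bar>ev b - ev a\<bar>"
        using gap[of b a "ev b" "ev a"] that a Sb by (auto simp: near_def)
      thus False using that a by (auto simp: near_def)
    qed
    moreover have "\<bar>ev a - \<nu>\<bar> < \<mu>" using a by (simp add: near_def)
    ultimately show ?thesis by (rule that[rotated])
  qed
  have far: "\<mu> \<le> \<bar>ev b - \<nu>\<bar>" "ev b \<noteq> \<kappa>" "b \<in> S" if "b \<in> far" for b
    using that \<kappa>(1) by (auto simp: far_def near_def)
  define u0 where "u0 = (\<Sum>b\<in>near. (u \<bullet> b) *\<^sub>R b)"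
  define u1 where "u1 = (\<Sum>b\<in>far. (u \<bullet> b) *\<^sub>R b)"
  have nS: "near \<subseteq> S" "far \<subseteq> S" by (auto simp: near_def far_def)
  have "u = u0 + u1"
    unfolding u0_def u1_def far_def
    by (subst add.commute, subst sum.subset_diff[OF nS(1) Sb(1), symmetric])
       (simp add: eigenbasis_expansion[OF S])
  moreover have "f u0 = \<kappa> *\<^sub>R u0"
  proof -
    have "f u0 = (\<Sum>b\<in>near. (u \<bullet> b) *\<^sub>R f b)"
      by (simp add: u0_def linear_sum[OF lin] linear_scale[OF lin])
    also have "\<dots> = (\<Sum>b\<in>near. \<kappa> *\<^sub>R ((u \<bullet> b) *\<^sub>R b))"
      by (rule sum.cong) (use \<kappa>(2) Sb(3) nS in auto)
    finally show ?thesis by (simp add: u0_def scaleR_sum_right)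
  qed
  moreover have "\<mu> * norm u1 \<le> norm (f u - \<nu> *\<^sub>R u)"
  proof -
    have "f u - \<nu> *\<^sub>R u = (\<Sum>b\<in>S. (ev b * (u \<bullet> b)) *\<^sub>R b) - \<nu> *\<^sub>R (\<Sum>b\<in>S. (u \<bullet> b) *\<^sub>R b)"
      by (simp add: eigenbasis_expansion[OF S] flip: eigenbasis_apply[OF S lin])
    also have "\<dots> = (\<Sum>b\<in>S. ((ev b - \<nu>) * (u \<bullet> b)) *\<^sub>R b)"
      by (simp add: scaleR_sum_right algebra_simps flip: sum_subtractf)
    finally have eq: "(norm (f u - \<nu> *\<^sub>R u))\<^sup>2 = (\<Sum>b\<in>S. ((ev b - \<nu>) * (u \<bullet> b))\<^sup>2)"
      by (simp only: eigenbasis_norm_sum[OF S order.refl])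
    have "(\<mu> * norm u1)\<^sup>2 = (\<Sum>b\<in>far. (\<mu> * (u \<bullet> b))\<^sup>2)"
      unfolding u1_def power_mult_distrib
      by (simp add: eigenbasis_norm_sum[OF S nS(2)] sum_distrib_left)
    also have "\<dots> \<le> (\<Sum>b\<in>far. ((ev b - \<nu>) * (u \<bullet> b))\<^sup>2)"
    proof (rule sum_mono)
      fix b assume "b \<in> far"
      hence "\<mu>\<^sup>2 \<le> (ev b - \<nu>)\<^sup>2" using far(1)[of b] \<mu> by (simp add: abs_le_square_iff[symmetric])
      thus "(\<mu> * (u \<bullet> b))\<^sup>2 \<le> ((ev b - \<nu>) * (u \<bullet> b))\<^sup>2"
        by (simp add: power_mult_distrib mult_right_mono)
    qed
    also have "\<dots> \<le> (\<Sum>b\<in>S. ((ev b - \<nu>) * (u \<bullet> b))\<^sup>2)"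
      by (rule sum_mono2) (use Sb nS in auto)
    finally show ?thesis unfolding eq[symmetric] by (rule power2_le_imp_le) simp
  qed
  moreover have "u1 \<bullet> x = 0" if x: "f x = \<kappa> *\<^sub>R x" for x
  proof -
    have "b \<bullet> x = 0" if "b \<in> far" for b
    proof -
      have "ev b * (b \<bullet> x) = f b \<bullet> x" using Sb(3) far(3)[OF that] by simp
      also have "\<dots> = \<kappa> * (b \<bullet> x)" using selfadjoint_inner[OF f] x by simp
      finally show ?thesis using far(2)[OF that] by simp
    qed
    thus ?thesis by (simp add: u1_def inner_sum_left)
  qed
  ultimately show ?thesis by (rule that)
qed

lemma linear_norm_le:
  fixes f :: "'a::euclidean_space \<Rightarrow> 'b::real_normed_vector"
  assumes "linear f"
  obtains C where "C > 0" "\<And>x. norm (f x) \<le> C * norm x"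
proof -
  have "bounded_linear f" using assms by (simp add: linear_conv_bounded_linear)
  from bounded_linear.pos_bounded[OF this] show ?thesis using that by (auto simp: mult.commute)
qed

lemma selfadjoint_matrix: "transpose A = A \<Longrightarrow> selfadjoint ((*v) (A::real^'n^'n))"
  unfolding selfadjoint_def
  by (metis dot_lmul_matrix matrix_vector_mul_linear transpose_matrix_vector)

lemma sym_pd_imp_sym_psd: "sym_pd A \<Longrightarrow> sym_psd A"
  unfolding sym_pd_def sym_psd_def by (metis inner_zero_left less_eq_real_def)

lemma sym_psd_selfadjoint: "sym_psd A \<Longrightarrow> selfadjoint ((*v) A)"
  by (simp add: sym_psd_def selfadjoint_matrix)

lemma transpose_eq_of_selfadjoint:
  assumes "selfadjoint ((*v) (A::real^'n^'n))"
  shows "transpose A = A"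
proof -
  have "(transpose A *v x) \<bullet> y = (A *v x) \<bullet> y" for x y
    using selfadjoint_inner[OF assms, of x y] by (simp add: dot_lmul_matrix)
  hence "transpose A *v x = A *v x" for x
    using vector_eq_rdot[of "transpose A *v x" "A *v x"] by blast
  thus ?thesis unfolding matrix_eq by blast
qed

lemma sym_psd_kernel:
  assumes "sym_psd A" "x \<bullet> (A *v x) = 0"
  shows "A *v x = 0"
  by (rule selfadjoint_psd_kernel[OF sym_psd_selfadjoint, of A UNIV]) (use assms in \<open>auto simp: sym_psd_def\<close>)

lemma sym_psd_root_exists:
  assumes A: "sym_psd (A::real^'n^'n)"
  shows "\<exists>S. sym_psd S \<and> S ** S = A"
proof -
  have sa: "selfadjoint ((*v) A)" by (rule sym_psd_selfadjoint[OF A])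
  obtain Bs ev where Bs: "eigenbasis ((*v) A) ev Bs" by (rule selfadjoint_eigenbasis[OF sa])
  have b: "finite Bs" "\<And>b. b \<in> Bs \<Longrightarrow> b \<bullet> b = 1" "\<And>b. b \<in> Bs \<Longrightarrow> A *v b = ev b *\<^sub>R b"
    "\<And>b c. b \<in> Bs \<Longrightarrow> c \<in> Bs \<Longrightarrow> b \<noteq> c \<Longrightarrow> b \<bullet> c = 0"
    using Bs by (auto simp: eigenbasis_def pairwise_def orthogonal_def dot_square_norm)
  have ev: "ev c \<ge> 0" if "c \<in> Bs" for c
  proof -
    have "0 \<le> c \<bullet> (A *v c)" using A by (simp add: sym_psd_def)
    thus ?thesis using b(2,3)[OF that] by simp
  qed
  define g where "g x = (\<Sum>b\<in>Bs. (sqrt (ev b) * (x \<bullet> b)) *\<^sub>R b)" for x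
  have g: "linear g" unfolding g_def
    by (rule linearI)
       (simp_all add: inner_add_left algebra_simps sum.distrib scaleR_sum_right)
  define S where "S = matrix g"
  have Sg: "S *v x = g x" for x unfolding S_def by (simp add: matrix_works g)
  have gb: "g c = sqrt (ev c) *\<^sub>R c" if "c \<in> Bs" for c
  proof -
    have "g c = (\<Sum>b\<in>Bs. if b = c then sqrt (ev c) *\<^sub>R c else 0)"
      unfolding g_def by (rule sum.cong) (use b that in auto)
    thus ?thesis using b(1) that by simp
  qed
  have "g (g x) = A *v x" for x
  proof -
    have "g (g x) = (\<Sum>b\<in>Bs. (sqrt (ev b) * (x \<bullet> b)) *\<^sub>R g b)"
      by (subst (2) g_def) (simp add: linear_sum[OF g] linear_scale[OF g])
    also have "\<dots> = (\<Sum>b\<in>Bs. (ev b * (x \<bullet> b)) *\<^sub>R b)"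
      by (rule sum.cong) (use ev in \<open>auto simp: gb\<close>)
    also have "\<dots> = A *v x" using eigenbasis_apply[OF Bs] by simp
    finally show ?thesis .
  qed
  hence "S ** S = A" by (simp add: matrix_eq Sg flip: matrix_vector_mul_assoc)
  moreover have "transpose S = S"
  proof (rule transpose_eq_of_selfadjoint)
    show "selfadjoint ((*v) S)"
      unfolding selfadjoint_def by (auto simp: Sg g_def inner_sum_left inner_sum_right mult_ac inner_commute)
  qed
  moreover have "0 \<le> x \<bullet> (S *v x)" for x
  proof -
    have "x \<bullet> g x = (\<Sum>b\<in>Bs. sqrt (ev b) * (x \<bullet> b)\<^sup>2)"
      by (simp add: g_def inner_sum_right power2_eq_square mult_ac)
    also have "\<dots> \<ge> 0" using ev by (intro sum_nonneg) auto
    finally show ?thesis by (simp add: Sg)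
  qed
  ultimately show ?thesis by (auto simp: sym_psd_def)
qed

text \<open>On an eigenvector \<open>b\<close> of \<open>T\<close> with eigenvalue \<open>\<tau>\<close> one has
  \<open>(S + \<tau>) (S b - \<tau> b) = 0\<close>. For \<open>\<tau> > 0\<close> the operator \<open>S + \<tau>\<close> is positive definite, and for
  \<open>\<tau> = 0\<close> the identity \<open>\<bar>S b\<bar>\<^sup>2 = b \<bullet> S\<^sup>2 b = 0\<close> applies.\<close>

lemma sym_psd_root_unique:
  assumes S: "sym_psd (S::real^'n^'n)" and T: "sym_psd T" and eq: "S ** S = T ** T"
  shows "S = T"
proof -
  obtain Bs ev where Bs: "eigenbasis ((*v) T) ev Bs"
    by (rule selfadjoint_eigenbasis[OF sym_psd_selfadjoint[OF T]])
  have "S *v b = T *v b" if "b \<in> Bs" for b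
  proof -
    have b: "b \<bullet> b = 1" "T *v b = ev b *\<^sub>R b"
      using Bs that by (auto simp: eigenbasis_def dot_square_norm)
    define \<tau> where "\<tau> = ev b"
    have Tb: "T *v b = \<tau> *\<^sub>R b" using b by (simp add: \<tau>_def)
    have "0 \<le> b \<bullet> (T *v b)" using T by (simp add: sym_psd_def)
    hence \<tau>: "\<tau> \<ge> 0" using b by (simp add: \<tau>_def)
    have SS: "S *v (S *v b) = (\<tau> * \<tau>) *\<^sub>R b"
      by (simp add: matrix_vector_mul_assoc eq) (simp add: Tb matrix_vector_mult_scaleR flip: matrix_vector_mul_assoc)
    define d where "d = S *v b - \<tau> *\<^sub>R b"
    have "S *v d = - \<tau> *\<^sub>R d"
      by (simp add: d_def matrix_vector_mult_diff_distrib matrix_vector_mult_scaleR SS algebra_simps)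
    moreover have "0 \<le> d \<bullet> (S *v d)" using S by (simp add: sym_psd_def)
    ultimately have d: "\<tau> * (d \<bullet> d) \<le> 0" by simp
    show ?thesis
    proof (cases "\<tau> = 0")
      case True
      have "(S *v b) \<bullet> (S *v b) = b \<bullet> (S *v (S *v b))"
        by (rule selfadjoint_inner[OF sym_psd_selfadjoint[OF S]])
      thus ?thesis using SS True Tb by simp
    next
      case False
      with d \<tau> have "d \<bullet> d \<le> 0" by (simp add: mult_le_0_iff)
      hence "d = 0" using inner_gt_zero_iff not_less by blast
      thus ?thesis using Tb by (simp add: d_def)
    qed
  qed
  note eq_on = this
  have expand: "X *v x = (\<Sum>b\<in>Bs. (x \<bullet> b) *\<^sub>R (X *v b))" for X :: "real^'n^'n" and x
    using arg_cong[OF eigenbasis_expansion[OF Bs, of x], of "(*v) X"]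
    by (simp add: linear_sum[OF matrix_vector_mul_linear] matrix_vector_mult_scaleR)
  have "(\<Sum>b\<in>Bs. (x \<bullet> b) *\<^sub>R (S *v b)) = (\<Sum>b\<in>Bs. (x \<bullet> b) *\<^sub>R (T *v b))" for x
    by (rule sum.cong) (simp_all add: eq_on)
  hence "S *v x = T *v x" for x
    by (metis expand)
  thus ?thesis by (simp add: matrix_eq)
qed

text \<open>Existence and uniqueness of the positive semidefinite root make the definite description in
  \<^const>\<open>matrix_sqrt\<close> meaningful; everything needed later about the change of variables
  \<open>y = M\<^sup>1\<^sup>/\<^sup>2 x\<close> follows from the equations collected here.\<close>

lemma inv_sqrt_props:
  assumes M: "sym_pd (M::real^'n^'n)"
  obtains S where "transpose S = S" "S ** S = M" "S ** inv_sqrt M = mat 1" "inv_sqrt M ** S = mat 1"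
    "transpose (inv_sqrt M) = inv_sqrt M"
proof -
  note psd = sym_pd_imp_sym_psd[OF M]
  define S where "S = matrix_sqrt M"
  have "\<exists>!S. sym_psd S \<and> S ** S = M"
    using sym_psd_root_exists[OF psd] sym_psd_root_unique by blast
  from theI'[OF this] have S: "sym_psd S" "S ** S = M" by (auto simp: S_def matrix_sqrt_def)
  have St: "transpose S = S" using S by (simp add: sym_psd_def)
  have "x = 0" if "S *v x = 0" for x
  proof (rule ccontr)
    assume "x \<noteq> 0"
    hence "0 < x \<bullet> (M *v x)" using M by (simp add: sym_pd_def)
    thus False using that by (simp flip: S(2) matrix_vector_mul_assoc)
  qed
  hence "invertible S"
    by (simp add: invertible_left_inverse matrix_left_invertible_ker)
  hence "\<exists>A'. S ** A' = mat 1 \<and> A' ** S = mat 1" by (simp add: invertible_def)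
  from someI_ex[OF this] have inv: "S ** inv_sqrt M = mat 1" "inv_sqrt M ** S = mat 1"
    unfolding inv_sqrt_def matrix_inv_def S_def[symmetric] by auto
  have "transpose (inv_sqrt M) ** S = mat 1"
    using arg_cong[OF inv(1), of transpose] by (simp add: matrix_transpose_mul St transpose_mat)
  hence "transpose (inv_sqrt M) = inv_sqrt M"
    using inv by (metis matrix_mul_assoc matrix_mul_lid matrix_mul_rid)
  with St S(2) inv show ?thesis using that by blast
qed

section \<open>Linear systems with positive semidefinite damping\<close>

text \<open>A compactness principle in the spirit of LaSalle: if \<open>\<phi>\<close> stayed away from zero along a sequence
  of times, a convergent subsequence of the bounded function would have a limit point at which all
  \<open>\<psi> m\<close> vanish but \<open>\<phi>\<close> does not.\<close>

lemma vanish_if_limit_points_vanish: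
  fixes f :: "real \<Rightarrow> 'a::euclidean_space" and \<phi> :: "'a \<Rightarrow> 'c::real_normed_vector"
    and \<psi> :: "'i \<Rightarrow> 'a \<Rightarrow> 'b::real_normed_vector"
  assumes V: "closed V" "\<And>t. t \<ge> 0 \<Longrightarrow> f t \<in> V" and bd: "\<And>t. t \<ge> 0 \<Longrightarrow> norm (f t) \<le> C"
    and \<psi>0: "\<And>m. ((\<lambda>t. \<psi> m (f t)) \<longlongrightarrow> 0) at_top"
    and cont: "\<And>m. continuous_on UNIV (\<psi> m)" "continuous_on UNIV \<phi>"
    and imp: "\<And>a. a \<in> V \<Longrightarrow> (\<And>m. \<psi> m a = 0) \<Longrightarrow> \<phi> a = 0"
  shows "((\<lambda>t. \<phi> (f t)) \<longlongrightarrow> 0) at_top"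
proof (rule ccontr)
  assume "\<not> ?thesis"
  then obtain e where e: "e > 0" "\<not> eventually (\<lambda>t. norm (\<phi> (f t)) < e) at_top"
    by (auto simp: tendsto_iff)
  have "\<exists>t\<ge>T. norm (\<phi> (f t)) \<ge> e" for T
    using e(2) by (auto simp: eventually_at_top_linorder not_less)
  hence "\<forall>n. \<exists>s. s \<ge> real n \<and> norm (\<phi> (f s)) \<ge> e" by blast
  from choice[OF this] obtain t where t: "\<And>n. t n \<ge> real n" "\<And>n. norm (\<phi> (f (t n))) \<ge> e" by blast
  have t0: "t n \<ge> 0" for n using t(1)[of n] by linarith
  have "compact (V \<inter> cball 0 C)" by (rule closed_Int_compact[OF V(1)]) simp
  moreover have "\<forall>n. f (t n) \<in> V \<inter> cball 0 C" using V(2) bd t0 by auto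
  ultimately obtain a r where a: "a \<in> V \<inter> cball 0 C" "strict_mono r"
    and lim: "((\<lambda>n. f (t n)) \<circ> r) \<longlonglongrightarrow> a"
    unfolding compact_def by metis
  have tr: "filterlim (\<lambda>n. t (r n)) at_top sequentially"
  proof (rule filterlim_at_top_mono[OF filterlim_real_sequentially always_eventually], rule allI)
    fix n show "real n \<le> t (r n)"
      using t(1)[of "r n"] seq_suble[OF a(2), of n] by linarith
  qed
  have lim': "(\<lambda>n. f (t (r n))) \<longlonglongrightarrow> a" using lim by (simp add: o_def)
  have "\<psi> m a = 0" for m
  proof (rule LIMSEQ_unique)
    show "(\<lambda>n. \<psi> m (f (t (r n)))) \<longlonglongrightarrow> \<psi> m a"
      by (rule continuous_on_tendsto_compose[OF cont(1) lim']) auto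
    show "(\<lambda>n. \<psi> m (f (t (r n)))) \<longlonglongrightarrow> 0"
      by (rule filterlim_compose[OF \<psi>0 tr])
  qed
  with a(1) imp have "\<phi> a = 0" by blast
  moreover have "(\<lambda>n. norm (\<phi> (f (t (r n))))) \<longlonglongrightarrow> norm (\<phi> a)"
    by (intro tendsto_norm continuous_on_tendsto_compose[OF cont(2) lim']) auto
  hence "e \<le> norm (\<phi> a)"
    by (rule LIMSEQ_le_const) (use t(2) in auto)
  ultimately show False using e(1) by simp
qed

lemma mean_value_within:
  fixes f :: "real \<Rightarrow> real"
  assumes "\<And>t. t \<ge> 0 \<Longrightarrow> (f has_real_derivative f' t) (at t within {0..})" "0 \<le> a" "a \<le> b"
  obtains \<xi> where "a \<le> \<xi>" "\<xi> \<le> b" "f b - f a = f' \<xi> * (b - a)"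
proof -
  have "\<exists>x\<in>{a..b}. f b - f a = (\<lambda>h. f' x * h) (b - a)"
  proof (rule mvt_very_simple[OF assms(3)])
    fix x assume "a \<le> x" "x \<le> b"
    hence "(f has_real_derivative f' x) (at x within {a..b})"
      using assms(2) by (intro has_field_derivative_subset[OF assms(1)[of x]]) auto
    thus "(f has_derivative (\<lambda>h. f' x * h)) (at x within {a..b})"
      by (simp add: has_field_derivative_def)
  qed
  thus ?thesis using that by auto
qed

text \<open>Over a step of length \<open>h\<close> the mean value of \<open>f'\<close> is \<open>(f (t + h) - f t) / h\<close>, which tends to
  zero, while \<open>f'\<close> itself varies by at most \<open>C h\<close>.\<close>

lemma derivative_tendsto_0:
  fixes f f' f'' :: "real \<Rightarrow> real"
  assumes f: "\<And>t. t \<ge> 0 \<Longrightarrow> (f has_real_derivative f' t) (at t within {0..})"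
    and f': "\<And>t. t \<ge> 0 \<Longrightarrow> (f' has_real_derivative f'' t) (at t within {0..})"
    and bd: "\<And>t. t \<ge> 0 \<Longrightarrow> \<bar>f'' t\<bar> \<le> C" and lim: "(f \<longlongrightarrow> l) at_top"
  shows "(f' \<longlongrightarrow> 0) at_top"
proof (rule tendstoI)
  fix e :: real assume e: "e > 0"
  have C0: "C \<ge> 0" using bd[of 0] by linarith
  \<comment> \<open>Small enough that the variation \<open>C h\<close> costs less than half of \<open>e\<close>; the summand 1 covers \<open>C = 0\<close>.\<close>
  define h where "h = e / (2 * (C + 1))"
  have h: "h > 0" unfolding h_def using e C0 by simp
  have Ch: "C * h < e / 2" unfolding h_def using e C0 by (simp add: field_simps)
  have "((\<lambda>t. f (t + h)) \<longlongrightarrow> l) at_top"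
    by (rule filterlim_compose[OF lim])
       (rule filterlim_at_top_mono[OF filterlim_ident], use h in auto)
  from tendsto_diff[OF this lim] have "((\<lambda>t. f (t + h) - f t) \<longlongrightarrow> 0) at_top" by simp
  hence "eventually (\<lambda>t. \<bar>f (t + h) - f t\<bar> < h * (e / 2)) at_top"
    using h e by (auto simp: tendsto_iff dist_real_def dest: spec[of _ "h * (e / 2)"])
  thus "eventually (\<lambda>t. dist (f' t) 0 < e) at_top"
    using eventually_ge_at_top[of "0::real"]
  proof eventually_elim
    case (elim t)
    obtain \<xi> where \<xi>: "t \<le> \<xi>" "\<xi> \<le> t + h" "f (t + h) - f t = f' \<xi> * (t + h - t)"
      by (rule mean_value_within[OF f, of t "t + h"]) (use elim h in auto)
    obtain \<eta> where \<eta>: "t \<le> \<eta>" "f' \<xi> - f' t = f'' \<eta> * (\<xi> - t)"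
      by (rule mean_value_within[OF f', of t \<xi>]) (use elim \<xi> in auto)
    have "h * \<bar>f' \<xi>\<bar> < h * (e / 2)" using elim(1) \<xi>(3) h by (simp add: abs_mult mult.commute)
    hence "\<bar>f' \<xi>\<bar> < e / 2" using h by simp
    moreover have "\<bar>f' \<xi> - f' t\<bar> \<le> C * h"
      unfolding \<eta>(2) abs_mult by (rule mult_mono) (use bd[of \<eta>] \<eta> \<xi> elim C0 in auto)
    ultimately show ?case using Ch by (simp add: dist_real_def)
  qed
qed

lemma decreasing_bounded_tendsto:
  fixes f :: "real \<Rightarrow> real"
  assumes dec: "\<And>s t. 0 \<le> s \<Longrightarrow> s \<le> t \<Longrightarrow> f t \<le> f s" and bd: "\<And>t. t \<ge> 0 \<Longrightarrow> B \<le> f t"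
  obtains l where "(f \<longlongrightarrow> l) at_top"
proof
  define l where "l = Inf (f ` {0..})"
  have bb: "bdd_below (f ` {0..})" using bd by (auto intro!: bdd_belowI[of _ B])
  have l: "l \<le> f t" if "t \<ge> 0" for t
    unfolding l_def by (rule cInf_lower[OF _ bb]) (use that in auto)
  show "(f \<longlongrightarrow> l) at_top"
  proof (rule order_tendstoI)
    fix a assume "a < l"
    show "eventually (\<lambda>t. a < f t) at_top"
      using eventually_ge_at_top[of "0::real"] by eventually_elim (use \<open>a < l\<close> l in fastforce)
  next
    fix a assume "l < a"
    then obtain T where T: "T \<ge> 0" "f T < a"
      using cInf_less_iff[of "f ` {0..}" a] bb by (auto simp: l_def)
    show "eventually (\<lambda>t. f t < a) at_top"
      using eventually_ge_at_top[of T] by eventually_elim (use T dec[of T] in fastforce)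
  qed
qed

lemma coercive:
  fixes Q :: "'a::euclidean_space \<Rightarrow> 'a"
  assumes Q: "linear Q" and pd: "\<And>x. x \<noteq> 0 \<Longrightarrow> 0 < x \<bullet> Q x"
  obtains c where "c > 0" "\<And>x. c * (norm x)\<^sup>2 \<le> x \<bullet> Q x"
proof -
  have "continuous_on (sphere 0 1) (\<lambda>x. x \<bullet> Q x)"
    by (intro continuous_on_inner continuous_on_id linear_continuous_on)
       (simp add: Q flip: linear_conv_bounded_linear)
  moreover have "sphere (0::'a) 1 \<noteq> {}" by simp
  ultimately obtain x where x: "x \<in> sphere 0 1" "\<And>y. y \<in> sphere 0 1 \<Longrightarrow> x \<bullet> Q x \<le> y \<bullet> Q y"
    using continuous_attains_inf[of "sphere 0 1" "\<lambda>x. x \<bullet> Q x"] by auto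
  show ?thesis
  proof (rule that[of "x \<bullet> Q x"])
    show "0 < x \<bullet> Q x" using x(1) by (intro pd) auto
    show "(x \<bullet> Q x) * (norm y)\<^sup>2 \<le> y \<bullet> Q y" for y
    proof (cases "y = 0")
      case False
      have "x \<bullet> Q x \<le> (y /\<^sub>R norm y) \<bullet> Q (y /\<^sub>R norm y)" using False by (intro x(2)) simp
      also have "\<dots> = (y \<bullet> Q y) / (norm y)\<^sup>2"
        by (simp add: linear_scale[OF Q] power2_eq_square divide_inverse mult_ac)
      finally show ?thesis using False by (simp add: pos_le_divide_eq)
    qed simp
  qed
qed

text \<open>A solution, with its velocity, of \<open>z'' + L z' + Q z = 0\<close> on the closed half line.\<close>

definition damped_solution ::
  "('a::euclidean_space \<Rightarrow> 'a) \<Rightarrow> ('a \<Rightarrow> 'a) \<Rightarrow> (real \<Rightarrow> 'a) \<Rightarrow> (real \<Rightarrow> 'a) \<Rightarrow> bool" where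
  "damped_solution Q L z z' \<longleftrightarrow>
     (\<forall>t\<ge>0. (z has_vector_derivative z' t) (at t within {0..}) \<and>
            (z' has_vector_derivative - Q (z t) - L (z' t)) (at t within {0..}))"

lemma linear_has_vector_derivative:
  fixes f :: "'a::euclidean_space \<Rightarrow> 'b::real_normed_vector"
  assumes "linear f" "(z has_vector_derivative z') F"
  shows "((\<lambda>t. f (z t)) has_vector_derivative f z') F"
  using bounded_linear.has_vector_derivative[of f] assms by (simp add: linear_conv_bounded_linear)

lemma linear_funpow:
  fixes f :: "'a::real_vector \<Rightarrow> 'a"
  shows "linear f \<Longrightarrow> linear (f ^^ m)"
proof (induction m)
  case 0
  show ?case using linear_id by (simp add: id_def)
next
  case (Suc m)
  show ?case unfolding funpow.simps by (rule linear_compose[OF Suc.IH[OF Suc.prems] Suc.prems])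
qed

text \<open>The equation is linear and autonomous, so velocities solve it again; hence whatever holds for
  every solution holds for all its higher derivatives.\<close>

lemma damped_solution_derivative:
  assumes "linear Q" "linear L" "damped_solution Q L z z'"
  shows "damped_solution Q L z' (\<lambda>t. - Q (z t) - L (z' t))"
  unfolding damped_solution_def
proof safe
  fix t :: real assume "t \<ge> 0"
  hence d: "(z has_vector_derivative z' t) (at t within {0..})"
    "(z' has_vector_derivative - Q (z t) - L (z' t)) (at t within {0..})"
    using assms(3) by (auto simp: damped_solution_def)
  show "(z' has_vector_derivative - Q (z t) - L (z' t)) (at t within {0..})" by (rule d(2))
  show "((\<lambda>t. - Q (z t) - L (z' t)) has_vector_derivative - Q (z' t) - L (- Q (z t) - L (z' t)))
      (at t within {0..})"
    by (intro has_vector_derivative_diff has_vector_derivative_minus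
        linear_has_vector_derivative[OF assms(1)] linear_has_vector_derivative[OF assms(2)] d)
qed

lemma damped_solution_commuting:
  assumes c: "linear c" "\<And>x. c (Q x) = Q (c x)" "\<And>x. c (L x) = L (c x)" and "damped_solution Q L z z'"
  shows "damped_solution Q L (\<lambda>t. c (z t)) (\<lambda>t. c (z' t))"
  unfolding damped_solution_def
proof safe
  fix t :: real assume "t \<ge> 0"
  hence d: "(z has_vector_derivative z' t) (at t within {0..})"
    "(z' has_vector_derivative - Q (z t) - L (z' t)) (at t within {0..})"
    using assms(4) by (auto simp: damped_solution_def)
  show "((\<lambda>t. c (z t)) has_vector_derivative c (z' t)) (at t within {0..})"
    by (rule linear_has_vector_derivative[OF c(1) d(1)])
  have "c (- Q (z t) - L (z' t)) = - Q (c (z t)) - L (c (z' t))"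
    by (simp add: linear_diff[OF c(1)] linear_neg[OF c(1)] c)
  with linear_has_vector_derivative[OF c(1) d(2)]
  show "((\<lambda>t. c (z' t)) has_vector_derivative - Q (c (z t)) - L (c (z' t))) (at t within {0..})"
    by simp
qed

context
  fixes Q L :: "'a::euclidean_space \<Rightarrow> 'a"
  assumes Q: "selfadjoint Q" "\<And>x. x \<noteq> 0 \<Longrightarrow> 0 < x \<bullet> Q x"
    and L: "selfadjoint L" "\<And>x. 0 \<le> x \<bullet> L x"
begin

text \<open>The energy \<open>\<bar>z'\<bar>\<^sup>2 + z \<bullet> Q z\<close> has derivative \<open>- 2 z' \<bullet> L z' \<le> 0\<close>. It bounds position and
  velocity and, being monotone, converges; its second derivative is bounded, so the dissipation
  tends to zero, and positive semidefiniteness turns this into \<open>L z' \<longlongrightarrow> 0\<close>.\<close>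

lemma damped_solution_energy:
  assumes sol: "damped_solution Q L z z'"
  obtains C where "\<And>t. t \<ge> 0 \<Longrightarrow> norm (z t) \<le> C" "\<And>t. t \<ge> 0 \<Longrightarrow> norm (z' t) \<le> C"
    "((\<lambda>t. L (z' t)) \<longlongrightarrow> 0) at_top"
proof -
  note linQ = selfadjoint_linear[OF Q(1)] and linL = selfadjoint_linear[OF L(1)]
  define z'' where "z'' t = - Q (z t) - L (z' t)" for t
  have d: "(z has_vector_derivative z' t) (at t within {0..})"
    "(z' has_vector_derivative z'' t) (at t within {0..})" if "t \<ge> 0" for t
    using sol that by (auto simp: damped_solution_def z''_def)
  define E where "E t = z' t \<bullet> z' t + z t \<bullet> Q (z t)" for t
  define g where "g t = -2 * (z' t \<bullet> L (z' t))" for t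
  define g' where "g' t = -4 * (z'' t \<bullet> L (z' t))" for t
  have dE: "(E has_real_derivative g t) (at t within {0..})" if t: "t \<ge> 0" for t
  proof -
    have "((\<lambda>t. z' t \<bullet> z' t + z t \<bullet> Q (z t)) has_vector_derivative
        (z' t \<bullet> z'' t + z'' t \<bullet> z' t) + (z t \<bullet> Q (z' t) + z' t \<bullet> Q (z t))) (at t within {0..})"
      by (intro has_vector_derivative_add bounded_bilinear.has_vector_derivative[OF bounded_bilinear_inner]
          linear_has_vector_derivative[OF linQ] d t)
    moreover have "(z' t \<bullet> z'' t + z'' t \<bullet> z' t) + (z t \<bullet> Q (z' t) + z' t \<bullet> Q (z t)) = g t"
      using selfadjoint_inner[OF Q(1), of "z t" "z' t"]
      by (simp add: z''_def g_def inner_diff_right inner_diff_left inner_commute)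
    ultimately show ?thesis
      by (simp add: has_real_derivative_iff_has_vector_derivative E_def[abs_def])
  qed
  have dg: "(g has_real_derivative g' t) (at t within {0..})" if t: "t \<ge> 0" for t
  proof -
    have "((\<lambda>t. z' t \<bullet> L (z' t)) has_vector_derivative
        (z' t \<bullet> L (z'' t) + z'' t \<bullet> L (z' t))) (at t within {0..})"
      by (intro bounded_bilinear.has_vector_derivative[OF bounded_bilinear_inner]
          linear_has_vector_derivative[OF linL] d t)
    moreover have "z' t \<bullet> L (z'' t) + z'' t \<bullet> L (z' t) = 2 * (z'' t \<bullet> L (z' t))"
      using selfadjoint_inner[OF L(1), of "z' t" "z'' t"] by (simp add: inner_commute)
    ultimately have "((\<lambda>t. z' t \<bullet> L (z' t)) has_real_derivative 2 * (z'' t \<bullet> L (z' t))) (at t within {0..})"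
      by (simp add: has_real_derivative_iff_has_vector_derivative)
    from DERIV_cmult[OF this, of "-2"] show ?thesis by (simp add: g_def[abs_def] g'_def)
  qed
  have dec: "E t \<le> E s" if st: "0 \<le> s" "s \<le> t" for s t
  proof -
    obtain \<xi> where "E t - E s = g \<xi> * (t - s)" 
      by (rule mean_value_within[of E g s t]) (use dE st in auto)
    moreover have "g \<xi> * (t - s) \<le> 0"
      using L(2)[of "z' \<xi>"] st by (intro mult_nonpos_nonneg) (auto simp: g_def)
    ultimately show ?thesis by simp
  qed
  obtain c where c: "c > 0" "\<And>x. c * (norm x)\<^sup>2 \<le> x \<bullet> Q x" using coercive[OF linQ Q(2)] by blast
  have Qz: "0 \<le> z t \<bullet> Q (z t)" for t
    by (rule order.trans[OF _ c(2)]) (use c(1) in simp)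
  have Epos: "E t \<ge> 0" for t using Qz[of t] by (simp add: E_def)
  note E0 = Epos[of 0]
  define C where "C = sqrt (E 0) + sqrt (E 0 / c)"
  have bz: "norm (z t) \<le> C" and bz': "norm (z' t) \<le> C" if t: "t \<ge> 0" for t
  proof -
    have E: "(norm (z' t))\<^sup>2 + c * (norm (z t))\<^sup>2 \<le> E 0"
      using dec[OF order.refl t] c(2)[of "z t"] by (simp add: E_def power2_norm_eq_inner)
    have "c * (norm (z t))\<^sup>2 \<le> E 0" using E zero_le_power2[of "norm (z' t)"] by linarith
    hence "(norm (z t))\<^sup>2 \<le> E 0 / c" using c(1) by (simp add: field_simps)
    hence "norm (z t) \<le> sqrt (E 0 / c)" by (rule real_le_rsqrt)
    thus "norm (z t) \<le> C" using E0 by (simp add: C_def add_increasing)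
    have "(norm (z' t))\<^sup>2 \<le> E 0"
    proof -
      have "0 \<le> c * (norm (z t))\<^sup>2" using c(1) by simp
      with E show ?thesis by linarith
    qed
    hence "norm (z' t) \<le> sqrt (E 0)" by (rule real_le_rsqrt)
    moreover have "0 \<le> sqrt (E 0 / c)" using E0 c(1) by simp
    ultimately show "norm (z' t) \<le> C" unfolding C_def by linarith
  qed
  have C0: "C \<ge> 0" using bz[of 0] norm_ge_zero[of "z 0"] by linarith
  obtain CQ where CQ: "CQ > 0" "\<And>x. norm (Q x) \<le> CQ * norm x" using linear_norm_le[OF linQ] by metis
  obtain CL where CL: "CL > 0" "\<And>x. norm (L x) \<le> CL * norm x" using linear_norm_le[OF linL] by metis
  have bg: "\<bar>g' t\<bar> \<le> 4 * ((CQ * C + CL * C) * (CL * C))" if t: "t \<ge> 0" for t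
  proof -
    have QC: "norm (Q (z t)) \<le> CQ * C" and LC: "norm (L (z' t)) \<le> CL * C"
      using CQ CL bz[OF t] bz'[OF t] by (meson mult_left_mono order.trans less_imp_le)+
    have "norm (z'' t) \<le> norm (Q (z t)) + norm (L (z' t))"
      unfolding z''_def by (metis norm_minus_cancel norm_triangle_ineq4)
    hence "norm (z'' t) \<le> CQ * C + CL * C" using QC LC by linarith
    hence "norm (z'' t) * norm (L (z' t)) \<le> (CQ * C + CL * C) * (CL * C)"
      using LC CQ CL C0 by (intro mult_mono) auto
    with Cauchy_Schwarz_ineq2[of "z'' t" "L (z' t)"] show ?thesis
      by (simp add: g'_def abs_mult)
  qed
  obtain l where l: "(E \<longlongrightarrow> l) at_top"
    by (rule decreasing_bounded_tendsto[of E 0, OF dec Epos])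
  have "(g \<longlongrightarrow> 0) at_top" by (rule derivative_tendsto_0[OF dE dg bg l])
  from tendsto_mult_left[OF this, of "-1/2"]
  have form: "((\<lambda>t. z' t \<bullet> L (z' t)) \<longlongrightarrow> 0) at_top" by (simp add: g_def[abs_def])
  have contL: "continuous_on UNIV L"
    by (intro linear_continuous_on) (simp add: linL flip: linear_conv_bounded_linear)
  have "((\<lambda>t. L (z' t)) \<longlongrightarrow> 0) at_top"
  proof (rule vanish_if_limit_points_vanish[where V=UNIV and \<psi>="\<lambda>_::unit. \<lambda>x. x \<bullet> L x" and \<phi>=L and f=z' and C=C])
    show "L a = 0" if "\<And>m::unit. a \<bullet> L a = 0" for a
      by (rule selfadjoint_psd_kernel[OF L(1), of UNIV]) (use L that in auto)
  qed (auto intro!: bz' form contL continuous_intros)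
  with bz bz' show ?thesis using that by blast
qed

text \<open>From \<open>Q z' = - z''' - L z''\<close> the observable \<open>L Q\<^sup>m\<^sup>+\<^sup>1\<close> along a velocity is \<open>L Q\<^sup>m\<close> along the
  velocity of another solution, up to sign and to a term that contains \<open>L z''\<close> and tends to zero.\<close>

lemma damped_solution_observables:
  assumes "damped_solution Q L z z'"
  shows "((\<lambda>t. L ((Q ^^ m) (z' t))) \<longlongrightarrow> 0) at_top"
  using assms
proof (induction m arbitrary: z z')
  case 0
  show ?case by (rule damped_solution_energy[OF 0]) simp
next
  case (Suc m)
  note linQ = selfadjoint_linear[OF Q(1)] and linL = selfadjoint_linear[OF L(1)]
  have linT: "linear (\<lambda>x. L ((Q ^^ m) x))"
  proof -
    from linear_compose[OF linear_funpow[OF linQ] linL] show ?thesis by (simp add: o_def)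
  qed
  define z2 where "z2 t = - Q (z t) - L (z' t)" for t
  define z3 where "z3 t = - Q (z' t) - L (z2 t)" for t
  have s2: "damped_solution Q L z' z2"
    unfolding z2_def by (rule damped_solution_derivative[OF linQ linL Suc.prems])
  have s3: "damped_solution Q L z2 z3"
    unfolding z3_def by (rule damped_solution_derivative[OF linQ linL s2])
  have a: "((\<lambda>t. L ((Q ^^ m) (z3 t))) \<longlongrightarrow> 0) at_top" by (rule Suc.IH[OF s3])
  have "((\<lambda>t. L (z2 t)) \<longlongrightarrow> 0) at_top" by (rule damped_solution_energy[OF s2]) simp
  hence b: "((\<lambda>t. L ((Q ^^ m) (L (z2 t)))) \<longlongrightarrow> 0) at_top"
    using bounded_linear.tendsto_zero[of "\<lambda>x. L ((Q ^^ m) x)"] linT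
    by (simp add: linear_conv_bounded_linear)
  have eq: "L ((Q ^^ Suc m) (z' t)) = - L ((Q ^^ m) (z3 t)) - L ((Q ^^ m) (L (z2 t)))" for t
  proof -
    have "Q (z' t) = - z3 t - L (z2 t)" by (simp add: z3_def)
    hence "L ((Q ^^ Suc m) (z' t)) = L ((Q ^^ m) (- z3 t - L (z2 t)))"
      by (simp add: funpow_swap1)
    thus ?thesis by (simp add: linear_diff[OF linT] linear_neg[OF linT])
  qed
  show ?case unfolding eq using tendsto_diff[OF tendsto_minus[OF a] b] by simp
qed

text \<open>A limit point of the velocity is annihilated by every \<open>L Q\<^sup>m\<close>. The vectors of \<open>V\<close> with this
  property form a \<open>Q\<close>-invariant subspace of the kernel of \<open>L\<close>; if it were nonzero it would contain
  an eigenvector of \<open>Q\<close>, that is, an oscillation that the damping does not see.\<close>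

lemma damped_velocity_decay:
  assumes sol: "damped_solution Q L y y'" and V: "subspace V" "\<And>x. x \<in> V \<Longrightarrow> Q x \<in> V"
    and y': "\<And>t. t \<ge> 0 \<Longrightarrow> y' t \<in> V"
    and noeig: "\<And>x \<theta>. \<lbrakk>x \<in> V; L x = 0; Q x = \<theta> *\<^sub>R x\<rbrakk> \<Longrightarrow> x = 0"
  shows "(y' \<longlongrightarrow> 0) at_top"
proof -
  note linQ = selfadjoint_linear[OF Q(1)] and linL = selfadjoint_linear[OF L(1)]
  obtain C where C: "\<And>t. t \<ge> 0 \<Longrightarrow> norm (y' t) \<le> C" using damped_solution_energy[OF sol] by metis
  have linQm: "linear (Q ^^ m)" for m
    by (rule linear_funpow[OF linQ])
  have linT: "linear (\<lambda>x. L ((Q ^^ m) x))" for m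
    using linear_compose[OF linQm linL] by (simp add: o_def)
  define W where "W = {x \<in> V. \<forall>m. L ((Q ^^ m) x) = 0}"
  have W: "subspace W"
    using V(1) by (auto simp: W_def subspace_def linear_add[OF linT] linear_scale[OF linT] linear_0[OF linT])
  have QW: "Q x \<in> W" if "x \<in> W" for x
  proof -
    have "L ((Q ^^ m) (Q x)) = 0" for m
      using that[unfolded W_def] by (auto dest: spec[of _ "Suc m"] simp: funpow_swap1)
    thus ?thesis using that V(2) by (simp add: W_def)
  qed
  have W0: "W = {0}"
  proof (rule ccontr)
    assume "W \<noteq> {0}"
    from selfadjoint_eigenvector_in_subspace[OF Q(1) W QW this]
    obtain x \<kappa> where x: "x \<in> W" "norm x = 1" "Q x = \<kappa> *\<^sub>R x" by metis
    have "L ((Q ^^ 0) x) = 0" "x \<in> V" using x(1) unfolding W_def by blast+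
    hence "x = 0" using noeig[of x \<kappa>] x(3) by simp
    with x(2) show False by simp
  qed
  show ?thesis
  proof (rule vanish_if_limit_points_vanish[where V=V and \<psi>="\<lambda>m x. L ((Q ^^ m) x)" and \<phi>="\<lambda>x. x" and f=y' and C=C])
    show "closed V" by (rule closed_subspace[OF V(1)])
    show "a = 0" if "a \<in> V" "\<And>m. L ((Q ^^ m) a) = 0" for a
      using that W0 by (auto simp: W_def)
    show "continuous_on UNIV (\<lambda>x. L ((Q ^^ m) x))" for m
      by (intro linear_continuous_on) (simp add: linT flip: linear_conv_bounded_linear)
  qed (auto intro!: y' C damped_solution_observables[OF sol])
qed

text \<open>The map \<open>c\<close> commutes with the dynamics, so \<open>c z\<close> is again a solution, now in the invariant
  subspace \<open>range c\<close>. Its velocity and acceleration decay, whence \<open>Q c z \<longlongrightarrow> 0\<close>, and \<open>Q\<close> is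
  positive definite. Later \<open>c\<close> subtracts the average over the oscillators.\<close>

theorem damped_solution_decay:
  assumes sol: "damped_solution Q L z z'"
    and c: "linear c" "\<And>x. c (Q x) = Q (c x)" "\<And>x. c (L x) = L (c x)"
    and noeig: "\<And>x \<theta>. \<lbrakk>x \<in> range c; L x = 0; Q x = \<theta> *\<^sub>R x\<rbrakk> \<Longrightarrow> x = 0"
  shows "((\<lambda>t. c (z t)) \<longlongrightarrow> 0) at_top"
proof -
  note linQ = selfadjoint_linear[OF Q(1)] and linL = selfadjoint_linear[OF L(1)]
  have V: "subspace (range c)" using linear_subspace_image[OF c(1) subspace_UNIV] .
  have QV: "Q x \<in> range c" if "x \<in> range c" for x
    using that by (auto simp flip: c(2))
  define y where "y t = c (z t)" for t
  define y' where "y' t = c (z' t)" for t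
  define y2 where "y2 t = - Q (y t) - L (y' t)" for t
  have s1: "damped_solution Q L y y'"
    unfolding y_def y'_def by (rule damped_solution_commuting[OF c sol])
  have s2: "damped_solution Q L y' y2"
    unfolding y2_def by (rule damped_solution_derivative[OF linQ linL s1])
  have y2: "y2 t = c (- Q (z t) - L (z' t))" for t
    by (simp add: y2_def y_def y'_def c linear_diff[OF c(1)] linear_neg[OF c(1)])
  have "(y' \<longlongrightarrow> 0) at_top"
    by (rule damped_velocity_decay[OF s1 V QV _ noeig]) (auto simp: y'_def)
  moreover have y2_0: "(y2 \<longlongrightarrow> 0) at_top"
    by (rule damped_velocity_decay[OF s2 V QV _ noeig]) (auto simp: y2)
  ultimately have "((\<lambda>t. L (y' t)) \<longlongrightarrow> 0) at_top"
    using bounded_linear.tendsto_zero[of L] linL by (simp add: linear_conv_bounded_linear)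
  from tendsto_diff[OF tendsto_minus[OF y2_0] this]
  have Qy: "((\<lambda>t. Q (y t)) \<longlongrightarrow> 0) at_top" by (simp add: y2_def)
  obtain C where C: "\<And>t. t \<ge> 0 \<Longrightarrow> norm (y t) \<le> C" using damped_solution_energy[OF s1] by metis
  have "(y \<longlongrightarrow> 0) at_top"
  proof (rule vanish_if_limit_points_vanish[where V=UNIV and \<psi>="\<lambda>_::unit. Q" and \<phi>="\<lambda>x. x" and f=y and C=C])
    show "a = 0" if "\<And>m::unit. Q a = 0" for a
      using Q(2)[of a] that by auto
    show "continuous_on UNIV Q"
      by (intro linear_continuous_on) (simp add: linQ flip: linear_conv_bounded_linear)
  qed (auto intro!: C Qy)
  thus ?thesis by (simp add: y_def[abs_def])
qed

end

section \<open>Eigenvalue lists and the spectral constants\<close>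

text \<open>Used for evaluation of polynomials at a point and for the embedding of constants into
  polynomials.\<close>

lemma det_hom:
  fixes h :: "'a::comm_ring_1 \<Rightarrow> 'b::comm_ring_1" and A :: "'a^'n^'n"
  assumes h: "h 0 = 0" "h 1 = 1" "\<And>x y. h (x + y) = h x + h y" "\<And>x y. h (x * y) = h x * h y"
  shows "h (det A) = det (\<chi> i j. h (A $ i $ j))"
proof -
  have hsum: "h (sum f S) = (\<Sum>x\<in>S. h (f x))" for f :: "('n \<Rightarrow> 'n) \<Rightarrow> 'a" and S
    by (induction S rule: infinite_finite_induct) (simp_all add: h)
  have hprod: "h (prod f S) = (\<Prod>x\<in>S. h (f x))" for f :: "'n \<Rightarrow> 'a" and S
    by (induction S rule: infinite_finite_induct) (simp_all add: h)
  have "h (- 1) + h 1 = 0" by (simp add: h(1) flip: h(3))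
  hence neg: "h (- 1) = - 1" by (simp add: h(2) eq_neg_iff_add_eq_0)
  have hsign: "h (of_int (sign p)) = of_int (sign p)" for p :: "'n \<Rightarrow> 'n"
    by (simp add: sign_def neg h(2))
  show ?thesis by (simp add: det_def hsum hprod hsign h(4))
qed

lemma poly_char_polynomial: "poly (char_polynomial X) z = det (mat z - X)"
proof -
  have "poly (char_polynomial X) z = det (\<chi> i j. poly ((if i = j then [:0, 1:] else 0) - [:X $ i $ j:]) z)"
    unfolding char_polynomial_def by (subst det_hom[of "\<lambda>p. poly p z"]) simp_all
  also have "(\<chi> i j. poly ((if i = j then [:0, 1:] else 0) - [:X $ i $ j:]) z) = mat z - X"
    by (simp add: vec_eq_iff mat_def)
  finally show ?thesis .
qed

lemma degree_char_polynomial_le: "degree (char_polynomial (X::complex^'n^'n)) \<le> CARD('n)"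
proof -
  define a :: "'n \<Rightarrow> 'n \<Rightarrow> complex poly" where "a i j = (if i = j then [:0, 1:] else 0) - [:X $ i $ j:]" for i j
  have a: "degree (a i j) \<le> 1" for i j by (simp add: a_def)
  have "char_polynomial X = (\<Sum>p\<in>{p. p permutes UNIV}. of_int (sign p) * (\<Prod>i\<in>UNIV. a i (p i)))"
    by (simp add: char_polynomial_def det_def a_def)
  moreover have "degree (of_int (sign p) * (\<Prod>i\<in>UNIV. a i (p i))) \<le> CARD('n)" for p
  proof -
    have "degree (of_int (sign p) * (\<Prod>i\<in>UNIV. a i (p i))) \<le> degree (\<Prod>i\<in>UNIV. a i (p i))"
      using degree_mult_le[of "of_int (sign p)" "\<Prod>i\<in>UNIV. a i (p i)"] by simp
    also have "\<dots> \<le> (\<Sum>i\<in>UNIV. degree (a i (p i)))"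
      using degree_prod_sum_le[of UNIV "\<lambda>i. a i (p i)"] by (simp add: o_def)
    also have "\<dots> \<le> (\<Sum>i\<in>(UNIV::'n set). 1)" by (rule sum_mono) (rule a)
    finally show ?thesis by simp
  qed
  ultimately show ?thesis by (simp add: degree_sum_le)
qed

lemma mat_vector_mult: "mat z *v w = z *s (w::'a::comm_semiring_1^'n)"
  by (simp add: vec_eq_iff matrix_vector_mult_def mat_def vector_scalar_mult_def
      if_distrib[of "\<lambda>c. c * _"] cong: if_cong)

lemma of_real_smult: "complex_of_real r *s w = r *\<^sub>R w"
  by (simp add: vec_eq_iff vector_scalar_mult_def scaleR_conv_of_real[where 'a=complex])

lemma eigenvector_iff_det:
  fixes X :: "complex^'n^'n"
  shows "det (mat z - X) = 0 \<longleftrightarrow> (\<exists>w. w \<noteq> 0 \<and> X *v w = z *s w)"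
proof -
  have "det (mat z - X) = 0 \<longleftrightarrow> \<not> (\<forall>w. (mat z - X) *v w = 0 \<longrightarrow> w = 0)"
    by (metis invertible_det_nz invertible_left_inverse matrix_left_invertible_ker)
  moreover have "(mat z - X) *v w = z *s w - X *v w" for w
    by (simp add: matrix_vector_mult_diff_rdistrib mat_vector_mult)
  ultimately show ?thesis by (metis eq_iff_diff_eq_0)
qed

lemma linear_matrix_vector_complex: "linear ((*v) (X::complex^'n^'m))"
  by (rule linearI)
     (simp_all add: vec_eq_iff matrix_vector_mult_def sum.distrib scaleR_sum_right algebra_simps)

text \<open>A number of modulus larger than the operator norm is not an eigenvalue, hence not a root.\<close>

lemma char_polynomial_nonzero: "char_polynomial (X::complex^'n^'n) \<noteq> 0"
proof
  assume 0: "char_polynomial X = 0"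
  obtain C where C: "C > 0" "\<And>w. norm (X *v w) \<le> C * norm w"
    using linear_norm_le[OF linear_matrix_vector_complex] by metis
  have "det (mat (complex_of_real (C + 1)) - X) = 0"
    using 0 by (simp only: poly_char_polynomial[symmetric] poly_0)
  then obtain w where w: "w \<noteq> 0" "X *v w = complex_of_real (C + 1) *s w"
    by (auto simp: eigenvector_iff_det)
  with C(2)[of w] w(2) C(1) of_real_smult[of "C + 1" w] have "(C + 1) * norm w \<le> C * norm w" by simp
  with w(1) show False by simp
qed

lemma mset_eigenvalue_list: "mset (eigenvalue_list X) = proots (char_polynomial X)"
  unfolding eigenvalue_list_def using someI_ex[OF ex_mset] by simp

lemma sorted_eigenvalue_list: "sorted (map Re (eigenvalue_list X))"
  unfolding eigenvalue_list_def by simp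

lemma eigenvalue_listed:
  fixes X :: "complex^'n^'n"
  assumes "w \<noteq> 0" "X *v w = z *s w"
  obtains i where "i \<in> {1..CARD('n)}" "eigenval i X = z"
proof -
  have "poly (char_polynomial X) z = 0"
    unfolding poly_char_polynomial eigenvector_iff_det using assms by blast
  hence "z \<in> set (eigenvalue_list X)"
    by (simp add: char_polynomial_nonzero flip: set_mset_mset add: mset_eigenvalue_list)
  then obtain i where i: "i < length (eigenvalue_list X)" "eigenvalue_list X ! i = z"
    by (auto simp: in_set_conv_nth)
  have "length (eigenvalue_list X) \<le> CARD('n)"
    using size_proots_le[of "char_polynomial X"] degree_char_polynomial_le[of X]
    by (simp flip: size_mset add: mset_eigenvalue_list)
  with i show ?thesis by (intro that[of "Suc i"]) (auto simp: eigenval_def)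
qed

text \<open>Two linearly independent eigenvectors, here the all-ones vector (eigenvalue 0) and a nonconstant
  \<open>w\<close> (eigenvalue \<open>z\<close>), are put into columns \<open>a\<close> and \<open>b\<close> of a matrix \<open>S\<close> that otherwise is the
  identity. In \<open>(x I - X) S\<close> these two columns carry the factors \<open>x\<close> and \<open>x - z\<close>, which the
  determinant extracts, and \<open>det S\<close> is a nonzero constant. This counts multiplicities correctly
  also when \<open>z = 0\<close>.\<close>

lemma two_eigenvectors_dvd_char_polynomial:
  fixes X :: "complex^'n^'n"
  assumes one: "X *v 1 = 0" and w: "X *v w = z *s w" "w $ a \<noteq> w $ b"
  shows "[:0, 1:] * [:- z, 1:] dvd char_polynomial X"
proof -
  have ab: "a \<noteq> b" using w(2) by auto
  define S :: "complex^'n^'n" where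
    "S = (\<chi> i j. if j = a then 1 else if j = b then w $ i else if i = j then 1 else 0)"
  have row: "(S *v c) $ i = c $ a + w $ i * c $ b + (if i = a \<or> i = b then 0 else c $ i)" for c i
  proof -
    have "(S *v c) $ i = (\<Sum>j\<in>UNIV. (if j = a then c $ a else 0) + (if j = b then w $ i * c $ b else 0)
        + (if j = i then (if i = a \<or> i = b then 0 else c $ i) else 0))"
    proof -
      have "(S *v c) $ i = (\<Sum>j\<in>UNIV. S $ i $ j * c $ j)" by (simp add: matrix_vector_mult_def)
      also have "\<dots> = (\<Sum>j\<in>UNIV. (if j = a then c $ a else 0) + (if j = b then w $ i * c $ b else 0)
        + (if j = i then (if i = a \<or> i = b then 0 else c $ i) else 0))"
        by (rule sum.cong) (use ab in \<open>auto simp: S_def\<close>)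
      finally show ?thesis .
    qed
    thus ?thesis by (simp add: sum.distrib)
  qed
  \<comment> \<open>Rows \<open>a\<close> and \<open>b\<close> involve only \<open>c $ a\<close> and \<open>c $ b\<close>, with the nonzero minor \<open>w $ b - w $ a\<close>.\<close>
  have "c = 0" if "S *v c = 0" for c
  proof -
    have r: "c $ a + w $ i * c $ b + (if i = a \<or> i = b then 0 else c $ i) = 0" for i
      using row[of c i] that by simp
    have "(w $ a - w $ b) * c $ b = (c $ a + w $ a * c $ b) - (c $ a + w $ b * c $ b)"
      by (simp add: algebra_simps)
    also have "\<dots> = 0" using r[of a] r[of b] by simp
    finally have "c $ b = 0" using w(2) by simp
    moreover from this have "c $ a = 0" using r[of a] by simp
    ultimately show ?thesis using r by (simp add: vec_eq_iff split: if_splits) metis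
  qed
  hence detS: "det S \<noteq> 0"
    by (metis invertible_det_nz invertible_left_inverse matrix_left_invertible_ker)
  define A :: "complex poly^'n^'n" where "A = (\<chi> i j. (if i = j then [:0, 1:] else 0) - [:X $ i $ j:])"
  define SP :: "complex poly^'n^'n" where "SP = (\<chi> i j. [:S $ i $ j:])"
  have detSP: "det SP = [:det S:]"
    unfolding SP_def by (rule det_hom[symmetric]) simp_all
  define T :: "complex poly^'n^'n" where
    "T = (\<chi> i j. if j = a then 1 else if j = b then [:w $ i:] else (A ** SP) $ i $ j)"
  define c :: "'n \<Rightarrow> complex poly" where
    "c j = (if j = a then [:0, 1:] else if j = b then [:- z, 1:] else 1)" for j
  have const_sum: "(\<Sum>k\<in>UNIV. [:f k:]) = [:\<Sum>k\<in>UNIV. f k:]" for f :: "'n \<Rightarrow> complex"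
    by (induction "UNIV::'n set" rule: infinite_finite_induct) (rule poly_eqI, simp add: coeff_sum coeff_pCons split: nat.splits)+
  have entry: "(A ** SP) $ i $ j = [:0, 1:] * [:S $ i $ j:] - [:\<Sum>k\<in>UNIV. X $ i $ k * S $ k $ j:]" for i j
  proof -
    have "(A ** SP) $ i $ j = (\<Sum>k\<in>UNIV. (if k = i then [:0, 1:] * [:S $ i $ j:] else 0) - [:X $ i $ k * S $ k $ j:])"
      unfolding matrix_matrix_mult_def A_def SP_def
      by (simp, rule sum.cong) (auto simp: left_diff_distrib)
    thus ?thesis by (simp add: sum_subtractf const_sum)
  qed
  have Xa: "(\<Sum>k\<in>UNIV. X $ i $ k) = 0" for i
    using one by (simp add: vec_eq_iff matrix_vector_mult_def)
  have Xb: "(\<Sum>k\<in>UNIV. X $ i $ k * w $ k) = z * w $ i" for i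
    using w(1) by (simp add: vec_eq_iff matrix_vector_mult_def)
  have "(A ** SP) $ i $ j = c j * T $ i $ j" for i j
  proof -
    have "(A ** SP) $ i $ a = [:0, 1:]" by (simp add: entry S_def Xa)
    moreover have "(A ** SP) $ i $ b = [:- z, 1:] * [:w $ i:]"
      using ab by (simp add: entry S_def Xb)
    ultimately show ?thesis by (simp add: T_def c_def)
  qed
  hence "transpose (A ** SP) = (\<chi> j. c j *s (transpose T $ j))"
    by (simp add: vec_eq_iff transpose_def)
  hence "det (transpose (A ** SP)) = prod c UNIV * det (\<chi> j. transpose T $ j)"
    by (simp add: det_rows_mul)
  hence "det A * det SP = prod c UNIV * det T" by (simp add: det_mul)
  moreover have "prod c UNIV = [:0, 1:] * [:- z, 1:]"
  proof -
    have "prod c UNIV = prod c {a, b}"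
      by (rule prod.mono_neutral_right) (auto simp: c_def)
    thus ?thesis using ab by (simp add: c_def)
  qed
  ultimately have "char_polynomial X * [:det S:] = [:0, 1:] * [:- z, 1:] * det T"
    by (simp add: char_polynomial_def A_def detSP)
  hence "smult (det S) (char_polynomial X) = ([:0, 1:] * [:- z, 1:]) * det T"
    by (simp add: mult.commute)
  hence "([:0, 1:] * [:- z, 1:]) dvd smult (det S) (char_polynomial X)" by (rule dvdI)
  thus ?thesis using detS by (simp only: dvd_smult_iff simp_thms)
qed

lemma sorted_second_nonpos:
  assumes "sorted (map Re xs)" "{#x, y#} \<subseteq># mset xs" "Re x \<le> 0" "Re y \<le> 0"
  shows "Re (xs ! 1) \<le> 0"
proof (rule ccontr)
  assume pos: "\<not> Re (xs ! 1) \<le> 0"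
  have len: "2 \<le> length xs" using size_mset_mono[OF assms(2)] by simp
  then obtain x0 x1 r where xs: "xs = x0 # x1 # r"
    by (cases xs; cases "tl xs") auto
  have "filter (\<lambda>u. Re u \<le> 0) (x1 # r) = []"
    using assms(1) pos by (auto simp: xs filter_empty_conv)
  hence "length (filter (\<lambda>u. Re u \<le> 0) xs) \<le> 1" by (simp add: xs)
  moreover have "size (filter_mset (\<lambda>u. Re u \<le> 0) {#x, y#}) \<le> size (filter_mset (\<lambda>u. Re u \<le> 0) (mset xs))"
    by (intro size_mset_mono multiset_filter_mono assms(2))
  hence "2 \<le> length (filter (\<lambda>u. Re u \<le> 0) xs)"
    using assms(3,4) by (simp flip: mset_filter)
  ultimately show False by simp
qed

text \<open>Two entries of the sorted eigenvalue list have nonpositive real part, so its second entry has.\<close>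

lemma Re_second_eigenvalue_nonpos:
  fixes X :: "complex^'n^'n"
  assumes "X *v 1 = 0" "X *v w = z *s w" "w $ a \<noteq> w $ b" "Re z \<le> 0"
  shows "Re (eigenval 2 X) \<le> 0"
proof -
  obtain r where r: "char_polynomial X = [:0, 1:] * [:- z, 1:] * r"
    using two_eigenvectors_dvd_char_polynomial[OF assms(1-3)] by (rule dvdE)
  have "r \<noteq> 0" using r char_polynomial_nonzero[of X] by auto
  hence "proots (char_polynomial X) = {#0, z#} + proots r"
    unfolding r by (subst proots_mult, simp, simp, subst proots_mult) simp_all
  hence "{#0, z#} \<subseteq># mset (eigenvalue_list X)" by (simp add: mset_eigenvalue_list)
  from sorted_second_nonpos[OF sorted_eigenvalue_list this] assms(4)
  show ?thesis by (simp add: eigenval_def)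
qed

definition cvec :: "real^'n \<Rightarrow> complex^'n" where "cvec x = (\<chi> i. complex_of_real (x $ i))"
definition Re_vec :: "complex^'n \<Rightarrow> real^'n" where "Re_vec w = (\<chi> i. Re (w $ i))"
definition Im_vec :: "complex^'n \<Rightarrow> real^'n" where "Im_vec w = (\<chi> i. Im (w $ i))"

lemma cvec_0 [simp]: "cvec 0 = 0" and cvec_scaleR: "cvec (r *\<^sub>R x) = r *\<^sub>R cvec x"
  and Re_vec_scaleR: "Re_vec (r *\<^sub>R w) = r *\<^sub>R Re_vec w"
  and Im_vec_scaleR: "Im_vec (r *\<^sub>R w) = r *\<^sub>R Im_vec w"
  by (simp_all add: vec_eq_iff cvec_def Re_vec_def Im_vec_def scaleR_conv_of_real[where 'a=complex])

lemma Re_vec_cmat: "Re_vec (cmat A *v w) = A *v Re_vec w"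
  and Im_vec_cmat: "Im_vec (cmat A *v w) = A *v Im_vec w"
  by (simp_all add: vec_eq_iff Re_vec_def Im_vec_def cmat_def matrix_vector_mult_def)

lemma complex_vec_eq_iff: "v = w \<longleftrightarrow> Re_vec v = Re_vec w \<and> Im_vec v = Im_vec w"
  by (auto simp: vec_eq_iff Re_vec_def Im_vec_def complex_eq_iff)

lemma Re_vec_cvec [simp]: "Re_vec (cvec x) = x" and Im_vec_cvec [simp]: "Im_vec (cvec x) = 0"
  by (simp_all add: vec_eq_iff Re_vec_def Im_vec_def cvec_def)

lemma hermitian_form_parts:
  "hermitian_form A w = Re_vec w \<bullet> (A *v Re_vec w) + Im_vec w \<bullet> (A *v Im_vec w)"
  unfolding hermitian_form_def Re_vec_cmat[symmetric] Im_vec_cmat[symmetric]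
  by (simp add: inner_vec_def Re_vec_def Im_vec_def sum.distrib)

lemma norm_complex_vec: "(norm w)\<^sup>2 = (norm (Re_vec w))\<^sup>2 + (norm (Im_vec w))\<^sup>2"
  by (simp add: norm_vec_def L2_set_def sum_nonneg Re_vec_def Im_vec_def cmod_power2 sum.distrib)

lemma cmat_cvec: "cmat A *v cvec x = cvec (A *v x)"
  by (simp add: complex_vec_eq_iff Re_vec_cmat Im_vec_cmat)

lemma cmat_eigenvalue_listed:
  fixes A :: "real^'q^'q"
  assumes "x \<noteq> 0" "A *v x = \<alpha> *\<^sub>R x"
  obtains i where "i \<in> {1..CARD('q)}" "eigenval i (cmat A) = complex_of_real \<alpha>"
proof (rule eigenvalue_listed)
  show "cvec x \<noteq> 0" using assms(1) by (auto simp: vec_eq_iff cvec_def)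
  show "cmat A *v cvec x = complex_of_real \<alpha> *s cvec x"
    by (simp add: cmat_cvec assms(2) cvec_scaleR of_real_smult)
qed

text \<open>The finite set whose minimum, halved, is \<^const>\<open>mu_bar\<close>.\<close>

definition eigenvalue_gaps :: "('n::finite \<Rightarrow> real^'q^'q) \<Rightarrow> real set" where
  "eigenvalue_gaps B = (\<Union>k. {cmod (eigenval i (cmat (B k)) - eigenval j (cmat (B k))) | i j.
      i \<in> {1..CARD('q)} \<and> j \<in> {1..CARD('q)} \<and>
      eigenval i (cmat (B k)) \<noteq> eigenval j (cmat (B k))})"

lemma finite_eigenvalue_gaps: "finite (eigenvalue_gaps (B::'n::finite \<Rightarrow> real^'q^'q))"
  unfolding eigenvalue_gaps_def
proof (rule finite_UN_I)
  fix k :: 'n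
  show "finite {cmod (eigenval i (cmat (B k)) - eigenval j (cmat (B k))) | i j.
      i \<in> {1..CARD('q)} \<and> j \<in> {1..CARD('q)} \<and> eigenval i (cmat (B k)) \<noteq> eigenval j (cmat (B k))}"
    by (rule finite_subset[of _ "(\<lambda>(i, j). cmod (eigenval i (cmat (B k)) - eigenval j (cmat (B k)))) `
        ({1..CARD('q)} \<times> {1..CARD('q)})"]) auto
qed simp

lemma eigenvalue_gap_listed:
  fixes B :: "'n::finite \<Rightarrow> real^'q^'q"
  assumes "x \<noteq> 0" "y \<noteq> 0" "B k *v x = \<alpha> *\<^sub>R x" "B k *v y = \<beta> *\<^sub>R y" "\<alpha> \<noteq> \<beta>"
  shows "\<bar>\<alpha> - \<beta>\<bar> \<in> eigenvalue_gaps B"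
proof -
  obtain i where i: "i \<in> {1..CARD('q)}" "eigenval i (cmat (B k)) = complex_of_real \<alpha>"
    by (rule cmat_eigenvalue_listed[OF assms(1,3)])
  obtain j where j: "j \<in> {1..CARD('q)}" "eigenval j (cmat (B k)) = complex_of_real \<beta>"
    by (rule cmat_eigenvalue_listed[OF assms(2,4)])
  have "\<bar>\<alpha> - \<beta>\<bar> = cmod (eigenval i (cmat (B k)) - eigenval j (cmat (B k)))"
    by (simp add: i j flip: of_real_diff)
  moreover have "eigenval i (cmat (B k)) \<noteq> eigenval j (cmat (B k))" using assms(5) by (simp add: i j)
  ultimately show ?thesis unfolding eigenvalue_gaps_def using i(1) j(1) by blast
qed

lemma mu_bar_gap:
  fixes B :: "'n::finite \<Rightarrow> real^'q^'q"
  assumes "x \<noteq> 0" "y \<noteq> 0" "B k *v x = \<alpha> *\<^sub>R x" "B k *v y = \<beta> *\<^sub>R y" "\<alpha> \<noteq> \<beta>"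
  shows "2 * mu_bar B \<le> \<bar>\<alpha> - \<beta>\<bar>"
  using Min_le[OF finite_eigenvalue_gaps eigenvalue_gap_listed[of x y B k, OF assms]]
  by (simp add: mu_bar_def eigenvalue_gaps_def)

lemma mu_bar_pos:
  fixes B :: "'n::finite \<Rightarrow> real^'q^'q"
  assumes "x \<noteq> 0" "y \<noteq> 0" "B k *v x = \<alpha> *\<^sub>R x" "B k *v y = \<beta> *\<^sub>R y" "\<alpha> \<noteq> \<beta>"
  shows "0 < mu_bar B"
proof -
  have "Min (eigenvalue_gaps B) \<in> eigenvalue_gaps B"
    using eigenvalue_gap_listed[of x y B k, OF assms] by (intro Min_in finite_eigenvalue_gaps) auto
  hence "0 < Min (eigenvalue_gaps B)" by (auto simp: eigenvalue_gaps_def)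
  thus ?thesis by (simp add: mu_bar_def eigenvalue_gaps_def)
qed

lemma sigma_bar_gap:
  fixes \<sigma> :: "'n::finite \<Rightarrow> real"
  assumes "k \<noteq> l"
  shows "2 * sigma_bar \<sigma> \<le> \<bar>\<sigma> k - \<sigma> l\<bar>"
proof -
  have "finite {\<bar>\<sigma> k - \<sigma> l\<bar> | k l. k \<noteq> l}"
    by (rule finite_subset[of _ "(\<lambda>(k, l). \<bar>\<sigma> k - \<sigma> l\<bar>) ` UNIV"]) auto
  from Min_le[OF this, of "\<bar>\<sigma> k - \<sigma> l\<bar>"] assms show ?thesis by (auto simp: sigma_bar_def)
qed

lemma sigma_bar_pos:
  fixes \<sigma> :: "'n::finite \<Rightarrow> real"
  assumes "inj \<sigma>" "CARD('n) \<ge> 2"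
  shows "0 < sigma_bar \<sigma>"
proof -
  let ?S = "{\<bar>\<sigma> k - \<sigma> l\<bar> | k l. k \<noteq> l}"
  have "finite ?S"
    by (rule finite_subset[of _ "(\<lambda>(k, l). \<bar>\<sigma> k - \<sigma> l\<bar>) ` UNIV"]) auto
  moreover have "?S \<noteq> {}"
  proof -
    obtain a b :: 'n where "a \<noteq> b"
      using assms(2) card_le_Suc0_iff_eq[of "UNIV::'n set"] by auto
    thus ?thesis by blast
  qed
  ultimately have "Min ?S \<in> ?S" by (rule Min_in)
  thus ?thesis using assms(1) by (auto simp: sigma_bar_def inj_def)
qed

lemma C_set_iff:
  "w \<in> C_set B \<longleftrightarrow> norm w = 1 \<and> (\<exists>\<mu>. cmat B *v w = \<mu> *\<^sub>R w) \<and> (\<Sum>i\<in>UNIV. w $ i) = 0"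
proof -
  have "(cmat B - mat (complex_of_real \<mu>)) *v w = cmat B *v w - \<mu> *\<^sub>R w" for \<mu>
    by (simp add: matrix_vector_mult_diff_rdistrib mat_vector_mult of_real_smult)
  moreover have "(\<Sum>i\<in>UNIV. complex_of_real (unit_ones $ i) * w $ i) =
      complex_of_real (1 / sqrt (real CARD('a))) * (\<Sum>i\<in>UNIV. w $ i)"
    by (simp add: unit_ones_def sum_distrib_left)
  ultimately show ?thesis by (simp add: C_set_def)
qed

lemma eigenvalue_eq_hermitian_form:
  assumes "norm w = 1" "cmat B *v w = \<mu> *\<^sub>R w"
  shows "\<mu> = hermitian_form B w"
proof -
  have "B *v Re_vec w = \<mu> *\<^sub>R Re_vec w" "B *v Im_vec w = \<mu> *\<^sub>R Im_vec w"
    by (simp_all add: assms(2) Re_vec_scaleR Im_vec_scaleR flip: Re_vec_cmat Im_vec_cmat)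
  hence "hermitian_form B w = \<mu> * (norm w)\<^sup>2"
    by (simp add: hermitian_form_parts norm_complex_vec power2_norm_eq_inner algebra_simps)
  thus ?thesis using assms(1) by simp
qed

lemma continuous_hermitian_form: "continuous_on S (hermitian_form A)"
proof -
  have lin: "linear (Re_vec :: complex^'n \<Rightarrow> real^'n)" "linear (Im_vec :: complex^'n \<Rightarrow> real^'n)"
    by (auto intro!: linearI simp: vec_eq_iff Re_vec_def Im_vec_def)
  have "continuous_on S (\<lambda>w. Re_vec w \<bullet> (A *v Re_vec w) + Im_vec w \<bullet> (A *v Im_vec w))"
    by (intro continuous_on_add continuous_on_inner
        linear_continuous_on_compose[OF linear_continuous_on matrix_vector_mul_linear] linear_continuous_on)
       (simp_all add: lin flip: linear_conv_bounded_linear)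
  thus ?thesis by (simp add: hermitian_form_parts)
qed

text \<open>The eigenvalue of a unit eigenvector is the value of the hermitian form there. This removes the
  existential quantifier and exhibits the set as cut out of the sphere by continuous equations.\<close>

lemma compact_C_set: "compact (C_set B)"
proof -
  have "C_set B = sphere 0 1 \<inter> ({w. cmat B *v w = hermitian_form B w *\<^sub>R w} \<inter> {w. (\<Sum>i\<in>UNIV. w $ i) = 0})"
  proof (rule set_eqI)
    fix w
    have "w \<in> C_set B \<longleftrightarrow> norm w = 1 \<and> cmat B *v w = hermitian_form B w *\<^sub>R w \<and> (\<Sum>i\<in>UNIV. w $ i) = 0"
      unfolding C_set_iff using eigenvalue_eq_hermitian_form[of w B] by metis
    thus "w \<in> C_set B \<longleftrightarrow> w \<in> sphere 0 1 \<inter>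
        ({w. cmat B *v w = hermitian_form B w *\<^sub>R w} \<inter> {w. (\<Sum>i\<in>UNIV. w $ i) = 0})"
      by simp
  qed
  moreover have "closed {w. cmat B *v w = hermitian_form B w *\<^sub>R w}"
    by (intro closed_Collect_eq continuous_on_scaleR continuous_hermitian_form continuous_on_id linear_continuous_on)
       (simp add: linear_matrix_vector_complex flip: linear_conv_bounded_linear)
  moreover have "closed {w::complex^'a. (\<Sum>i\<in>UNIV. w $ i) = 0}"
    by (intro closed_Collect_eq continuous_intros)
  ultimately show ?thesis by (simp add: compact_Int_closed closed_Int)
qed

lemma cvec_in_C_set:
  assumes "norm x = 1" "B *v x = \<mu> *\<^sub>R x" "(\<Sum>i\<in>UNIV. x $ i) = 0"
  shows "cvec x \<in> C_set B"
proof -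
  have "(norm (cvec x))\<^sup>2 = 1" using assms(1) by (simp add: norm_complex_vec)
  hence "norm (cvec x) = 1" by (simp add: power2_eq_1_iff) (metis norm_ge_zero not_one_le_zero neg_0_le_iff_le)
  moreover have "cmat B *v cvec x = \<mu> *\<^sub>R cvec x"
    by (simp add: cmat_cvec assms(2) cvec_scaleR)
  moreover have "(\<Sum>i\<in>UNIV. cvec x $ i) = 0"
    using assms(3) by (simp add: cvec_def flip: of_real_sum)
  ultimately show ?thesis by (auto simp: C_set_iff)
qed

lemma sum_eq_inner_1: "(\<Sum>i\<in>UNIV. x $ i) = 1 \<bullet> (x::real^'n)"
  by (simp add: inner_vec_def)

text \<open>The complement of the all-ones vector is an invariant subspace, nonzero as soon as there are two
  indices.\<close>

lemma C_set_nonempty: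
  fixes B :: "real^'q^'q"
  assumes B: "selfadjoint ((*v) B)" "B *v 1 = 0" and q: "CARD('q) \<ge> 2"
  shows "C_set B \<noteq> {}"
proof -
  define W where "W = {x::real^'q. 1 \<bullet> x = 0}"
  have W: "subspace W" unfolding W_def by (rule subspace_hyperplane)
  have BW: "B *v x \<in> W" if "x \<in> W" for x
    using selfadjoint_inner[OF B(1), of 1 x] B(2) by (simp add: W_def)
  obtain a b :: 'q where ab: "a \<noteq> b"
    using q card_le_Suc0_iff_eq[of "UNIV::'q set"] by auto
  have "axis a 1 - axis b 1 \<in> W" by (simp add: W_def inner_diff_right inner_axis)
  moreover have "axis a 1 - axis b (1::real) \<noteq> 0" using ab by (simp add: axis_eq_axis)
  ultimately have "W \<noteq> {0}" by blast
  from selfadjoint_eigenvector_in_subspace[OF B(1) W BW this]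
  obtain x \<kappa> where "x \<in> W" "norm x = 1" "B *v x = \<kappa> *\<^sub>R x" by metis
  hence "cvec x \<in> C_set B" by (intro cvec_in_C_set) (auto simp: W_def sum_eq_inner_1)
  thus ?thesis by blast
qed

text \<open>This is where the hypothesis on the second eigenvalue enters. If the form vanished at \<open>w\<close>, then
  \<open>A w = 0\<close> by positive semidefiniteness, and \<open>w\<close> would be an eigenvector of \<open>A + \<i> B\<close> with a purely
  imaginary eigenvalue, next to the all-ones vector with eigenvalue 0. Two eigenvalues would have
  real part 0.\<close>

lemma hermitian_form_pos_on_C_set:
  fixes A B :: "real^'q^'q"
  assumes A: "sym_psd A" "A *v 1 = 0" and B: "B *v 1 = 0"
    and pos: "Re (eigenval 2 (complex_matrix A B)) > 0" and w: "w \<in> C_set B"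
  shows "0 < hermitian_form A w"
proof (rule ccontr)
  assume "\<not> 0 < hermitian_form A w"
  moreover have nn: "0 \<le> x \<bullet> (A *v x)" for x using A(1) by (simp add: sym_psd_def)
  ultimately have "Re_vec w \<bullet> (A *v Re_vec w) = 0 \<and> Im_vec w \<bullet> (A *v Im_vec w) = 0"
    unfolding hermitian_form_parts using nn[of "Re_vec w"] nn[of "Im_vec w"] by linarith
  hence "A *v Re_vec w = 0" "A *v Im_vec w = 0" using sym_psd_kernel[OF A(1)] by auto
  hence Aw: "cmat A *v w = 0"
    by (simp add: complex_vec_eq_iff Re_vec_cmat Im_vec_cmat) (simp add: vec_eq_iff Re_vec_def Im_vec_def)
  obtain \<mu> where \<mu>: "cmat B *v w = \<mu> *\<^sub>R w" using w by (auto simp: C_set_iff)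
  have split: "complex_matrix A B *v u = cmat A *v u + \<i> *s (cmat B *v u)" for u
    by (simp add: vec_eq_iff matrix_vector_mult_def complex_matrix_def cmat_def sum.distrib
        sum_distrib_left algebra_simps)
  have ones: "cmat X *v 1 = 0" if "X *v 1 = 0" for X :: "real^'q^'q"
  proof -
    have "(1::complex^'q) = cvec 1" by (simp add: vec_eq_iff cvec_def)
    thus ?thesis by (metis cmat_cvec that cvec_0)
  qed
  have "complex_matrix A B *v 1 = 0"
    by (simp add: split ones A B)
  moreover have "complex_matrix A B *v w = (\<i> * complex_of_real \<mu>) *s w"
    unfolding split Aw \<mu> by (simp add: vec_eq_iff vector_scalar_mult_def scaleR_conv_of_real[where 'a=complex])
  moreover have "\<exists>a b. w $ a \<noteq> w $ b"
  proof (rule ccontr)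
    assume "\<not> ?thesis"
    hence c: "w $ i = w $ undefined" for i by blast
    have "(\<Sum>i\<in>UNIV. w $ i) = of_nat CARD('q) * w $ undefined"
      by (subst c) simp
    hence "w $ undefined = 0" using w by (simp add: C_set_iff)
    with c have "w = 0" by (simp add: vec_eq_iff)
    thus False using w by (simp add: C_set_iff)
  qed
  ultimately have "Re (eigenval 2 (complex_matrix A B)) \<le> 0"
    using Re_second_eigenvalue_nonpos[of "complex_matrix A B" w "\<i> * complex_of_real \<mu>"] by auto
  with pos show False by simp
qed

lemma gamma_bar_facts:
  fixes G B :: "'n::finite \<Rightarrow> real^'q^'q"
  assumes q: "CARD('q) \<ge> 2"
    and G: "\<And>k. sym_psd (G k)" "\<And>k. G k *v 1 = 0"
    and B: "\<And>k. selfadjoint ((*v) (B k))" "\<And>k. B k *v 1 = 0"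
    and pos: "\<And>k. Re (eigenval 2 (complex_matrix (G k) (B k))) > 0"
  shows gamma_bar_pos: "0 < gamma_bar G B"
    and gamma_bar_le: "\<And>k u \<mu>. \<lbrakk>B k *v u = \<mu> *\<^sub>R u; (\<Sum>i\<in>UNIV. u $ i) = 0\<rbrakk> \<Longrightarrow>
      (gamma_bar G B)\<^sup>2 * (norm u)\<^sup>2 \<le> u \<bullet> (G k *v u)"
proof -
  define f where "f k = (INF w\<in>C_set (B k). hermitian_form (G k) w)" for k
  have attain: "\<exists>w\<in>C_set (B k). f k = hermitian_form (G k) w \<and> (\<forall>u\<in>C_set (B k). f k \<le> hermitian_form (G k) u)" for k
  proof -
    obtain w where w: "w \<in> C_set (B k)" "\<And>u. u \<in> C_set (B k) \<Longrightarrow> hermitian_form (G k) w \<le> hermitian_form (G k) u"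
      using continuous_attains_inf[OF compact_C_set C_set_nonempty[OF B q] continuous_hermitian_form] by blast
    have "f k = hermitian_form (G k) w"
      unfolding f_def by (rule cInf_eq_minimum) (use w in auto)
    thus ?thesis using w by auto
  qed
  have fpos: "0 < f k" for k
    using attain[of k] hermitian_form_pos_on_C_set[OF G B(2) pos] by auto
  define m where "m = Min (range f)"
  have gb: "gamma_bar G B = sqrt m" by (simp add: gamma_bar_def f_def m_def)
  have "Min (range f) \<in> range f" by (rule Min_in) auto
  hence mpos: "0 < m" using fpos by (auto simp: m_def)
  thus "0 < gamma_bar G B" by (simp add: gb)
  fix k u \<mu> assume u: "B k *v u = \<mu> *\<^sub>R u" "(\<Sum>i\<in>UNIV. u $ i) = 0"
  show "(gamma_bar G B)\<^sup>2 * (norm u)\<^sup>2 \<le> u \<bullet> (G k *v u)"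
  proof (cases "u = 0")
    case False
    define x where "x = u /\<^sub>R norm u"
    have "cvec x \<in> C_set (B k)"
      using False u by (intro cvec_in_C_set[of _ _ \<mu>])
        (simp_all add: x_def matrix_vector_mult_scaleR flip: sum_distrib_left)
    hence "f k \<le> x \<bullet> (G k *v x)"
      using attain[of k] by (auto simp: hermitian_form_parts)
    moreover have "m \<le> f k" unfolding m_def by (rule Min_le) auto
    moreover have "x \<bullet> (G k *v x) = (u \<bullet> (G k *v u)) / (norm u)\<^sup>2"
      by (simp add: x_def matrix_vector_mult_scaleR power2_eq_square divide_inverse mult_ac)
    ultimately have "m \<le> (u \<bullet> (G k *v u)) / (norm u)\<^sup>2" by simp
    thus ?thesis using False mpos by (simp add: gb pos_le_divide_eq)
  qed simp
qed

section \<open>Block vectors and undamped modes\<close>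

text \<open>Vectors of \<open>real^('n \<times> 'q)\<close> consist of blocks indexed by the modes: \<open>blk\<close> extracts a block and
  \<open>emb\<close>, its adjoint, places a vector into a block.\<close>

definition emb :: "'n \<Rightarrow> real^'q \<Rightarrow> real^('n::finite \<times> 'q::finite)" where
  "emb k u = (\<chi> a. if fst a = k then u $ snd a else 0)"

definition blk :: "'n \<Rightarrow> real^('n::finite \<times> 'q::finite) \<Rightarrow> real^'q" where
  "blk k w = (\<chi> i. w $ (k, i))"

lemma sum_pairs: "(\<Sum>a\<in>UNIV. f a) = (\<Sum>k\<in>UNIV. \<Sum>i\<in>UNIV. f (k, i))"
  for f :: "'n::finite \<times> 'q::finite \<Rightarrow> 'a::comm_monoid_add"
  by (simp add: sum.cartesian_product)

lemma inner_pairs: "x \<bullet> y = (\<Sum>k\<in>UNIV. blk k x \<bullet> blk k y)"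
  by (simp add: inner_vec_def sum_pairs blk_def)

lemma blk_emb: "blk k (emb l u) = (if k = l then u else 0)"
  by (simp add: blk_def emb_def vec_eq_iff)

lemma blk_eqI: "(\<And>k. blk k x = blk k y) \<Longrightarrow> x = y"
  by (auto simp: blk_def vec_eq_iff)

lemma blk_linear: "linear (blk k)" and emb_linear: "linear (emb k)"
  by (auto intro!: linearI simp: blk_def emb_def vec_eq_iff)

lemma blk_simps: "blk k (x + y) = blk k x + blk k y" "blk k (x - y) = blk k x - blk k y"
    "blk k (c *\<^sub>R x) = c *\<^sub>R blk k x" "blk k 0 = 0"
  by (simp_all add: blk_def vec_eq_iff)

lemma inner_emb: "emb k u \<bullet> w = u \<bullet> blk k w"
proof -
  have "emb k u \<bullet> w = (\<Sum>l\<in>UNIV. if l = k then u \<bullet> blk k w else 0)"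
    unfolding inner_pairs by (rule sum.cong) (auto simp: blk_emb)
  thus ?thesis by simp
qed

lemma norm_emb: "norm (emb k u) = norm u"
  by (simp add: norm_eq_sqrt_inner inner_emb blk_emb)

lemma norm_blk_le: "norm (blk k w) \<le> norm w"
proof -
  have "(norm (blk k w))\<^sup>2 = emb k (blk k w) \<bullet> w"
    by (simp add: inner_emb power2_norm_eq_inner)
  also have "\<dots> \<le> norm (blk k w) * norm w"
    using Cauchy_Schwarz_ineq2[of "emb k (blk k w)" w] by (simp add: norm_emb)
  finally show ?thesis by (simp add: power2_eq_square)
    (metis mult_le_cancel_left_pos norm_ge_zero order.trans zero_less_norm_iff norm_zero)
qed

lemma blk_block_matrix_emb: "blk k (block_matrix X *v emb l u) = X k l *v u"
proof -
  have "(block_matrix X *v emb l u) $ (k, i) = (X k l *v u) $ i" for i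
  proof -
    have "(block_matrix X *v emb l u) $ (k, i) =
        (\<Sum>m\<in>UNIV. \<Sum>j\<in>UNIV. X k m $ i $ j * (if m = l then u $ j else 0))"
      by (simp only: matrix_vector_mult_def vec_lambda_beta, subst sum_pairs)
         (simp add: block_matrix_def emb_def cong: if_cong)
    also have "\<dots> = (\<Sum>m\<in>UNIV. if m = l then (\<Sum>j\<in>UNIV. X k l $ i $ j * u $ j) else 0)"
      by (rule sum.cong) auto
    finally show ?thesis by (simp add: matrix_vector_mult_def)
  qed
  thus ?thesis by (simp add: blk_def vec_eq_iff)
qed

lemma selfadjoint_diagonal_block:
  assumes "selfadjoint ((*v) (block_matrix X))"
  shows "selfadjoint ((*v) (X k k))"
  unfolding selfadjoint_def
proof safe
  fix x y
  have "(X k k *v x) \<bullet> y = (block_matrix X *v emb k x) \<bullet> emb k y"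
    by (simp add: inner_emb blk_block_matrix_emb inner_commute[of _ "emb k y"] inner_commute[of y])
  also have "\<dots> = emb k x \<bullet> (block_matrix X *v emb k y)" by (rule selfadjoint_inner[OF assms])
  also have "\<dots> = x \<bullet> (X k k *v y)" by (simp add: inner_emb blk_block_matrix_emb)
  finally show "(X k k *v x) \<bullet> y = x \<bullet> (X k k *v y)" .
qed simp

lemma sym_psd_diagonal_block:
  assumes "sym_psd (block_matrix X)"
  shows "sym_psd (X k k)"
proof -
  have "0 \<le> x \<bullet> (X k k *v x)" for x
  proof -
    have "0 \<le> emb k x \<bullet> (block_matrix X *v emb k x)" using assms by (simp add: sym_psd_def)
    thus ?thesis by (simp add: inner_emb blk_block_matrix_emb)
  qed
  moreover have "transpose (X k k) = X k k"
    by (rule transpose_eq_of_selfadjoint[OF selfadjoint_diagonal_block[OF sym_psd_selfadjoint[OF assms]]])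
  ultimately show ?thesis by (simp add: sym_psd_def)
qed

lemma matrix_norm_le: "norm (A *v x) \<le> matrix_norm A * norm x"
  unfolding matrix_norm_def by (rule onorm[OF matrix_vector_mul_bounded_linear])

lemma matrix_norm_nonneg: "0 \<le> matrix_norm A"
  unfolding matrix_norm_def by (rule onorm_pos_le[OF matrix_vector_mul_bounded_linear])

text \<open>The quantitative core. A mode \<open>w\<close> with \<open>G w = 0\<close> solves
  \<open>(\<sigma>\<^sub>k - \<theta>) w\<^sub>k + \<epsilon> (B w)\<^sub>k = 0\<close> in every block. At most one \<open>\<sigma>\<^sub>m\<close> is within \<open>s\<close> of \<open>\<theta>\<close>, so the
  other blocks, collected in \<open>h\<close>, are of size \<open>O(\<epsilon>)\<close>. Block \<open>m\<close> then is an approximate eigenvector of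
  \<open>B\<^sub>m\<^sub>m\<close>, that is, a true eigenvector \<open>u0\<close> without average plus an error \<open>u1\<close> of size \<open>O(\<epsilon>)\<close>.
  On \<open>u0\<close> the damping form is at least \<open>\<gamma>\<^sup>2 \<bar>u0\<bar>\<^sup>2\<close>. But \<open>G w = 0\<close> makes it equal to the form at the
  error \<open>e = u1 + h\<close>, which is at most \<open>\<parallel>G\<parallel> \<bar>e\<bar>\<^sup>2\<close>. For small \<open>\<epsilon>\<close> these are incompatible.\<close>

theorem undamped_mode_vanishes:
  fixes Gb Bb :: "'n::finite \<Rightarrow> 'n \<Rightarrow> real^'q^'q"
    and w :: "real^('n \<times> 'q)"
  defines "G \<equiv> block_matrix Gb" and "B \<equiv> block_matrix Bb"
  assumes G: "sym_psd G" and B: "selfadjoint ((*v) B)" and B1: "\<And>k. Bb k k *v 1 = 0"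
    and s: "s > 0" "\<And>k l. k \<noteq> l \<Longrightarrow> 2 * s \<le> \<bar>\<sigma> k - \<sigma> l\<bar>"
    and \<mu>: "\<mu> > 0" "\<And>k x y \<alpha> \<beta>. \<lbrakk>x \<noteq> 0; y \<noteq> 0; Bb k k *v x = \<alpha> *\<^sub>R x; Bb k k *v y = \<beta> *\<^sub>R y; \<alpha> \<noteq> \<beta>\<rbrakk>
        \<Longrightarrow> 2 * \<mu> \<le> \<bar>\<alpha> - \<beta>\<bar>"
    and \<gamma>: "\<gamma> > 0" "\<And>k u \<alpha>. \<lbrakk>Bb k k *v u = \<alpha> *\<^sub>R u; (\<Sum>i\<in>UNIV. u $ i) = 0\<rbrakk>
        \<Longrightarrow> \<gamma>\<^sup>2 * (norm u)\<^sup>2 \<le> u \<bullet> (Gb k k *v u)"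
    and \<epsilon>: "\<epsilon> > 0"
      "(sqrt (matrix_norm G) + \<gamma>) * (\<epsilon> * matrix_norm B * (\<mu> + matrix_norm B)) < \<gamma> * (s * \<mu>)"
    and w: "G *v w = 0" "\<And>k. (\<Sum>i\<in>UNIV. blk k w $ i) = 0"
      "\<And>k. \<sigma> k *\<^sub>R blk k w + \<epsilon> *\<^sub>R blk k (B *v w) = \<theta> *\<^sub>R blk k w"
  shows "w = 0"
proof (rule ccontr)
  assume "w \<noteq> 0"
  define g where "g = matrix_norm G"
  define b where "b = matrix_norm B"
  have g0: "g \<ge> 0" and b0: "b \<ge> 0" by (auto simp: g_def b_def matrix_norm_nonneg)
  obtain m where far: "\<And>k. k \<noteq> m \<Longrightarrow> s \<le> \<bar>\<theta> - \<sigma> k\<bar>"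
  proof (cases "\<exists>m. \<bar>\<theta> - \<sigma> m\<bar> < s")
    case True
    then obtain m where m: "\<bar>\<theta> - \<sigma> m\<bar> < s" by blast
    show ?thesis
    proof (rule that[of m])
      fix k assume "k \<noteq> m"
      from s(2)[OF this] m show "s \<le> \<bar>\<theta> - \<sigma> k\<bar>" by linarith
    qed
  next
    case False
    thus ?thesis by (intro that[of undefined]) (meson not_less)
  qed
  define u where "u = blk m w"
  define h where "h = w - emb m u"
  have w_eq: "w = emb m u + h" by (simp add: h_def)
  have hk: "blk k h = (if k = m then 0 else blk k w)" for k
    by (simp add: h_def blk_simps blk_emb u_def)

  have h_small: "s * norm h \<le> \<epsilon> * b * norm w"
  proof -
    have "norm (s *\<^sub>R h) \<le> norm (\<epsilon> *\<^sub>R (B *v w))"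
    proof (rule norm_le_componentwise_cart)
      fix a :: "'n \<times> 'q"
      obtain k i where a: "a = (k, i)" by (cases a)
      show "norm ((s *\<^sub>R h) $ a) \<le> norm ((\<epsilon> *\<^sub>R (B *v w)) $ a)"
      proof (cases "k = m")
        case True
        have "h $ a = blk k h $ i" by (simp add: blk_def a)
        thus ?thesis using True by (simp add: hk)
      next
        case False
        have ha: "h $ a = w $ a" using hk[of k] False by (simp add: a blk_def vec_eq_iff)
        have "\<sigma> k * w $ a + \<epsilon> * (B *v w) $ a = \<theta> * w $ a"
          using arg_cong[OF w(3)[of k], of "\<lambda>x. x $ i"] by (simp add: a blk_def)
        hence "\<epsilon> * (B *v w) $ a = (\<theta> - \<sigma> k) * w $ a" by (simp add: algebra_simps)
        moreover have "s * \<bar>w $ a\<bar> \<le> \<bar>\<theta> - \<sigma> k\<bar> * \<bar>w $ a\<bar>"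
          by (rule mult_right_mono[OF far[OF False]]) simp
        ultimately show ?thesis using s(1) by (simp add: ha abs_mult flip: abs_mult[of \<epsilon>])
      qed
    qed
    also have "\<dots> \<le> \<epsilon> * (b * norm w)"
      using \<epsilon>(1) matrix_norm_le[of B w] by (simp add: b_def)
    finally show ?thesis using s(1) by (simp add: mult.assoc)
  qed

  have u_approx: "norm (Bb m m *v u - ((\<theta> - \<sigma> m) / \<epsilon>) *\<^sub>R u) \<le> b * norm h"
  proof -
    have "blk m (B *v w) = Bb m m *v u + blk m (B *v h)"
      unfolding B_def by (subst w_eq) (simp add: matrix_vector_right_distrib blk_simps blk_block_matrix_emb)
    moreover have "blk m (B *v w) = ((\<theta> - \<sigma> m) / \<epsilon>) *\<^sub>R u"
    proof -
      have "\<epsilon> *\<^sub>R blk m (B *v w) = (\<theta> - \<sigma> m) *\<^sub>R u"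
        using w(3)[of m] by (simp add: u_def scaleR_left_diff_distrib eq_diff_eq add.commute)
      hence "(1 / \<epsilon>) *\<^sub>R \<epsilon> *\<^sub>R blk m (B *v w) = (1 / \<epsilon>) *\<^sub>R (\<theta> - \<sigma> m) *\<^sub>R u" by simp
      thus ?thesis using \<epsilon>(1) by simp
    qed
    ultimately have "Bb m m *v u - ((\<theta> - \<sigma> m) / \<epsilon>) *\<^sub>R u = - blk m (B *v h)" by simp
    thus ?thesis
      using norm_blk_le[of m "B *v h"] matrix_norm_le[of B h] by (simp add: b_def)
  qed
  have sa: "selfadjoint ((*v) (Bb m m))"
    using B unfolding B_def by (rule selfadjoint_diagonal_block)
  obtain u0 u1 \<kappa> where u: "u = u0 + u1" "Bb m m *v u0 = \<kappa> *\<^sub>R u0"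
      "\<mu> * norm u1 \<le> norm (Bb m m *v u - ((\<theta> - \<sigma> m) / \<epsilon>) *\<^sub>R u)"
    and orth: "\<And>x. Bb m m *v x = \<kappa> *\<^sub>R x \<Longrightarrow> u1 \<bullet> x = 0"
    by (rule approximate_eigenvector[OF sa \<mu>(1), where u=u and \<nu>="(\<theta> - \<sigma> m) / \<epsilon>"])
       (use \<mu>(2)[where k=m] in blast, rule that)
  have u1_small: "\<mu> * norm u1 \<le> b * norm h" using u(3) u_approx by linarith
  have u0_sum: "(\<Sum>i\<in>UNIV. u0 $ i) = 0"
  proof (cases "\<kappa> = 0")
    case True
    have "u1 \<bullet> 1 = 0" by (rule orth) (simp add: B1 True)
    moreover have "u \<bullet> 1 = 0" using w(2)[of m] by (simp add: u_def sum_eq_inner_1 inner_commute)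
    ultimately have "u0 \<bullet> 1 = 0" by (simp add: u(1) inner_add_left)
    thus ?thesis by (simp add: sum_eq_inner_1 inner_commute)
  next
    case False
    have "\<kappa> * (u0 \<bullet> 1) = (Bb m m *v u0) \<bullet> 1" by (simp add: u(2))
    also have "\<dots> = 0" by (simp add: selfadjoint_inner[OF sa] B1)
    finally show ?thesis using False by (simp add: sum_eq_inner_1 inner_commute)
  qed
  define e where "e = emb m u1 + h"
  have w_eq': "w = emb m u0 + e"
    by (simp add: e_def u(1) linear_add[OF emb_linear] flip: add.assoc) (simp add: w_eq u(1) linear_add[OF emb_linear])
  have damping: "\<gamma> * norm u0 \<le> sqrt g * norm e"
  proof -
    have G0: "G *v emb m u0 = - (G *v e)"
      using w(1) by (simp add: w_eq' matrix_vector_right_distrib eq_neg_iff_add_eq_0)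
    have "\<gamma>\<^sup>2 * (norm u0)\<^sup>2 \<le> u0 \<bullet> (Gb m m *v u0)" by (rule \<gamma>(2)[OF u(2) u0_sum])
    also have "\<dots> = emb m u0 \<bullet> (G *v emb m u0)" by (simp add: inner_emb G_def blk_block_matrix_emb)
    also have "\<dots> = - (emb m u0 \<bullet> (G *v e))" by (simp add: G0)
    also have "\<dots> = - ((G *v emb m u0) \<bullet> e)" by (simp add: selfadjoint_inner[OF sym_psd_selfadjoint[OF G]])
    also have "\<dots> = (G *v e) \<bullet> e" by (simp add: G0)
    also have "\<dots> \<le> norm (G *v e) * norm e" by (rule norm_cauchy_schwarz)
    also have "\<dots> \<le> (g * norm e) * norm e"
      unfolding g_def by (rule mult_right_mono[OF matrix_norm_le]) simp
    also have "\<dots> = (sqrt g * norm e)\<^sup>2" using g0 by (simp add: power_mult_distrib power2_eq_square)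
    finally have "(\<gamma> * norm u0)\<^sup>2 \<le> (sqrt g * norm e)\<^sup>2" by (simp add: power_mult_distrib)
    thus ?thesis by (rule power2_le_imp_le) (simp add: g0)
  qed
  have e_small: "(s * \<mu>) * norm e \<le> \<epsilon> * b * (\<mu> + b) * norm w"
  proof -
    have "norm e \<le> norm u1 + norm h"
      unfolding e_def using norm_triangle_ineq[of "emb m u1" h] by (simp add: norm_emb)
    hence "(s * \<mu>) * norm e \<le> (s * \<mu>) * (norm u1 + norm h)"
      using s(1) \<mu>(1) by (simp add: mult_left_mono)
    also have "\<dots> = s * (\<mu> * norm u1) + \<mu> * (s * norm h)" by (simp add: algebra_simps)
    also have "\<dots> \<le> s * (b * norm h) + \<mu> * (s * norm h)"
      using mult_left_mono[OF u1_small, of s] s(1) by simp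
    also have "\<dots> = (\<mu> + b) * (s * norm h)" by (simp add: algebra_simps)
    also have "\<dots> \<le> (\<mu> + b) * (\<epsilon> * b * norm w)"
      by (rule mult_left_mono[OF h_small]) (use \<mu>(1) b0 in simp)
    finally show ?thesis by (simp add: mult_ac)
  qed
  have "norm w \<le> norm u0 + norm e"
    using norm_triangle_ineq[of "emb m u0" e] by (simp add: norm_emb flip: w_eq')
  hence "\<gamma> * norm w \<le> \<gamma> * norm u0 + \<gamma> * norm e"
    using \<gamma>(1) by (simp add: mult_left_mono flip: distrib_left)
  with damping have "\<gamma> * norm w \<le> (sqrt g + \<gamma>) * norm e" by (simp add: algebra_simps)
  hence "(s * \<mu>) * (\<gamma> * norm w) \<le> (s * \<mu>) * ((sqrt g + \<gamma>) * norm e)"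
    using s(1) \<mu>(1) by (simp add: mult_left_mono)
  also have "\<dots> = (sqrt g + \<gamma>) * ((s * \<mu>) * norm e)" by (simp add: mult_ac)
  also have "\<dots> \<le> (sqrt g + \<gamma>) * (\<epsilon> * b * (\<mu> + b) * norm w)"
    by (rule mult_left_mono[OF e_small]) (use g0 \<gamma>(1) in simp)
  finally have "\<gamma> * (s * \<mu>) * norm w \<le> (sqrt g + \<gamma>) * (\<epsilon> * b * (\<mu> + b)) * norm w"
    by (simp add: mult_ac)
  hence "\<gamma> * (s * \<mu>) \<le> (sqrt g + \<gamma>) * (\<epsilon> * b * (\<mu> + b))"
    using \<open>w \<noteq> 0\<close> by simp
  with \<epsilon>(2) show False by (simp add: g_def b_def)
qed

section \<open>The coupling Laplacian in modal coordinates\<close>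

text \<open>The coordinates, in the eigenbasis \<open>v\<close>, of a family of vectors indexed by the oscillators. In the
  index pair the mode comes first, as in \<^const>\<open>block_matrix\<close>.\<close>

definition modal_vec :: "('n::finite \<Rightarrow> real^'n) \<Rightarrow> ('q::finite \<Rightarrow> real^'n) \<Rightarrow> real^('n \<times> 'q)" where
  "modal_vec v y = (\<chi> a. v (fst a) \<bullet> y (snd a))"

definition lap_block :: "('q::finite \<Rightarrow> 'q \<Rightarrow> real^'n^'n) \<Rightarrow> 'q \<Rightarrow> 'q \<Rightarrow> real^'n^'n" where
  "lap_block W i j = (if i = j then \<Sum>j\<in>UNIV. W i j else - W i j)"

lemma lap_entry: "lap W $ (i, a) $ (j, b) = lap_block W i j $ a $ b"
  by (simp add: lap_def lap_block_def)

lemma sum_kronecker: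
  fixes f :: "'q::finite \<Rightarrow> 'n::finite \<Rightarrow> 'a::comm_semiring_1"
  shows "(\<Sum>j\<in>UNIV. \<Sum>b\<in>UNIV. (if j = i then 1 else 0) * f j b) = (\<Sum>b\<in>UNIV. f i b)"
proof -
  have "(\<Sum>j\<in>UNIV. \<Sum>b\<in>UNIV. (if j = i then 1 else 0) * f j b)
      = (\<Sum>j\<in>UNIV. if j = i then (\<Sum>b\<in>UNIV. f i b) else 0)"
    by (rule sum.cong) auto
  thus ?thesis by simp
qed

lemma modal_block_entry:
  fixes W :: "'q::finite \<Rightarrow> 'q \<Rightarrow> real^'n^'n"
  shows "modal_block (lap W) v k l $ i $ j = v k \<bullet> (lap_block W i j *v v l)"
proof -
  have mat_entry: "mat 1 $ x $ y = (if x = y then 1 else (0::real))" for x y :: 'q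
    by (simp add: mat_def)
  have row: "(kron_row (mat 1) (v k) ** lap W) $ i $ (j, b) = (\<Sum>a\<in>UNIV. v k $ a * lap_block W i j $ a $ b)" for j b
  proof -
    have "(kron_row (mat 1) (v k) ** lap W) $ i $ (j, b) =
        (\<Sum>c\<in>UNIV. kron_row (mat 1) (v k) $ i $ c * lap W $ c $ (j, b))"
      by (simp add: matrix_matrix_mult_def)
    also have "\<dots> = (\<Sum>j'\<in>UNIV. \<Sum>a\<in>UNIV. (if j' = i then 1 else 0) * (v k $ a * lap_block W j' j $ a $ b))"
      by (subst sum_pairs, intro sum.cong refl) (simp add: kron_row_def mat_def lap_entry)
    finally show ?thesis by (simp only: sum_kronecker)
  qed
  have "modal_block (lap W) v k l $ i $ j =
      (\<Sum>c\<in>UNIV. (kron_row (mat 1) (v k) ** lap W) $ i $ c * kron_col (mat 1) (v l) $ c $ j)"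
    by (simp add: modal_block_def matrix_matrix_mult_def[of "kron_row (mat 1) (v k) ** lap W"])
  also have "\<dots> = (\<Sum>j'\<in>UNIV. \<Sum>b\<in>UNIV. (if j' = j then 1 else 0) *
      ((\<Sum>a\<in>UNIV. v k $ a * lap_block W i j' $ a $ b) * v l $ b))"
    by (subst sum_pairs, intro sum.cong refl) (simp add: kron_col_def mat_entry row)
  also have "\<dots> = (\<Sum>b\<in>UNIV. \<Sum>a\<in>UNIV. v k $ a * lap_block W i j $ a $ b * v l $ b)"
    by (simp only: sum_kronecker sum_distrib_right)
  also have "\<dots> = v k \<bullet> (lap_block W i j *v v l)"
    by (subst sum.swap) (simp add: inner_vec_def matrix_vector_mult_def sum_distrib_left mult.assoc)
  finally show ?thesis .
qed

lemma sum_matrix_vector: "(\<Sum>j\<in>S. W j) *v x = (\<Sum>j\<in>S. W j *v x)"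
  for W :: "'i \<Rightarrow> real^'n^'m"
  by (induction S rule: infinite_finite_induct) (auto simp: matrix_vector_mult_add_rdistrib)

lemma lap_block_apply:
  assumes "W i i = 0"
  shows "(\<Sum>j\<in>UNIV. lap_block W i j *v y j) = (\<Sum>j\<in>UNIV. W i j *v (y i - y j))"
proof -
  have neg: "(- A) *v x = - (A *v x)" for A :: "real^'n^'n" and x
    by (simp add: vec_eq_iff matrix_vector_mult_def sum_negf)
  have "(\<Sum>j\<in>UNIV. lap_block W i j *v y j) =
      (\<Sum>j\<in>UNIV. (if j = i then (\<Sum>j\<in>UNIV. W i j *v y i) else 0) - W i j *v y j)"
    by (rule sum.cong) (use assms in \<open>auto simp: lap_block_def sum_matrix_vector neg\<close>)
  also have "\<dots> = (\<Sum>j\<in>UNIV. W i j *v y i) - (\<Sum>j\<in>UNIV. W i j *v y j)"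
    by (simp add: sum_subtractf)
  finally show ?thesis by (simp add: matrix_vector_mult_diff_distrib sum_subtractf)
qed

locale modal_basis =
  fixes v :: "'n::finite \<Rightarrow> real^'n"
  assumes orthonormal: "v k \<bullet> v l = (if k = l then 1 else 0)"
    and expansion: "(\<Sum>k\<in>UNIV. (v k \<bullet> x) *\<^sub>R v k) = x"
begin

lemma parseval: "x \<bullet> y = (\<Sum>k\<in>UNIV. (v k \<bullet> x) * (v k \<bullet> y))"
proof -
  have "x \<bullet> y = (\<Sum>k\<in>UNIV. (v k \<bullet> x) *\<^sub>R v k) \<bullet> y" by (simp only: expansion)
  thus ?thesis by (simp add: inner_sum_left)
qed

lemma inner_modal_vec: "modal_vec v x \<bullet> modal_vec v y = (\<Sum>i\<in>UNIV. x i \<bullet> y i)"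
proof -
  have "modal_vec v x \<bullet> modal_vec v y = (\<Sum>k\<in>UNIV. \<Sum>i\<in>UNIV. (v k \<bullet> x i) * (v k \<bullet> y i))"
    by (simp add: inner_vec_def sum_pairs modal_vec_def)
  also have "\<dots> = (\<Sum>i\<in>UNIV. x i \<bullet> y i)"
    by (subst sum.swap) (simp flip: parseval)
  finally show ?thesis .
qed

lemma modal_vec_surj: obtains y where "w = modal_vec v y"
proof
  have "v k \<bullet> (\<Sum>l\<in>UNIV. w $ (l, i) *\<^sub>R v l) = w $ (k, i)" for k i
  proof -
    have "v k \<bullet> (\<Sum>l\<in>UNIV. w $ (l, i) *\<^sub>R v l) = (\<Sum>l\<in>UNIV. if l = k then w $ (k, i) else 0)"
      unfolding inner_sum_right by (rule sum.cong) (auto simp: orthonormal)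
    thus ?thesis by simp
  qed
  thus "w = modal_vec v (\<lambda>i. \<Sum>l\<in>UNIV. w $ (l, i) *\<^sub>R v l)"
    by (simp add: modal_vec_def vec_eq_iff)
qed

context
  fixes W :: "'q::finite \<Rightarrow> 'q \<Rightarrow> real^'n^'n"
  assumes W: "\<And>i j. sym_psd (W i j)" "\<And>i j. W i j = W j i" "\<And>i. W i i = 0"
begin

abbreviation "modal_lap \<equiv> block_matrix (modal_block (lap W) v)"

text \<open>In modal coordinates the Laplacian block matrix is the coupling operator
  \<open>y\<^sub>i \<mapsto> \<Sum>\<^sub>j W\<^sub>i\<^sub>j (y\<^sub>i - y\<^sub>j)\<close>; all its properties are read off from this.\<close>

lemma modal_lap_apply:
  "modal_lap *v modal_vec v y = modal_vec v (\<lambda>i. \<Sum>j\<in>UNIV. W i j *v (y i - y j))"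
proof -
  have "(modal_lap *v modal_vec v y) $ (k, i) = v k \<bullet> (\<Sum>j\<in>UNIV. W i j *v (y i - y j))" for k i
  proof -
    have "(modal_lap *v modal_vec v y) $ (k, i) =
        (\<Sum>l\<in>UNIV. \<Sum>j\<in>UNIV. (v k \<bullet> (lap_block W i j *v v l)) * (v l \<bullet> y j))"
      by (simp only: matrix_vector_mult_def[of modal_lap] vec_lambda_beta, subst sum_pairs)
         (simp add: block_matrix_def modal_block_entry modal_vec_def)
    also have "\<dots> = (\<Sum>j\<in>UNIV. \<Sum>l\<in>UNIV. (v k \<bullet> (lap_block W i j *v v l)) * (v l \<bullet> y j))"
      by (rule sum.swap)
    also have "\<dots> = (\<Sum>j\<in>UNIV. v k \<bullet> (lap_block W i j *v (\<Sum>l\<in>UNIV. (v l \<bullet> y j) *\<^sub>R v l)))"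
      by (simp add: linear_sum[OF matrix_vector_mul_linear] matrix_vector_mult_scaleR inner_sum_right mult.commute)
    also have "\<dots> = v k \<bullet> (\<Sum>j\<in>UNIV. lap_block W i j *v y j)"
      by (simp only: expansion inner_sum_right)
    finally show ?thesis by (simp only: lap_block_apply[OF W(3)])
  qed
  thus ?thesis by (simp add: vec_eq_iff modal_vec_def)
qed

text \<open>Exchanging the summation indices and averaging gives the usual Dirichlet form of a Laplacian.\<close>

lemma modal_lap_form:
  "modal_vec v x \<bullet> (modal_lap *v modal_vec v y) =
     (\<Sum>i\<in>UNIV. \<Sum>j\<in>UNIV. (x i - x j) \<bullet> (W i j *v (y i - y j))) / 2"
proof -
  define f where "f i j = x i \<bullet> (W i j *v (y i - y j))" for i j
  define g where "g i j = - (x j \<bullet> (W i j *v (y i - y j)))" for i j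
  have "modal_vec v x \<bullet> (modal_lap *v modal_vec v y) = (\<Sum>i\<in>UNIV. \<Sum>j\<in>UNIV. f i j)"
    by (simp add: modal_lap_apply inner_modal_vec inner_sum_right f_def)
  moreover have "(\<Sum>i\<in>UNIV. \<Sum>j\<in>UNIV. f i j) = (\<Sum>i\<in>UNIV. \<Sum>j\<in>UNIV. g i j)"
  proof (subst sum.swap, intro sum.cong refl)
    fix i j
    show "f j i = g i j"
      \<comment> \<open>The two minus signs, in \<open>g\<close> and in the reversed difference, cancel.\<close>
      using W(2)[of i j] by (simp add: f_def g_def matrix_vector_mult_diff_distrib inner_diff_right)
  qed
  moreover have "(\<Sum>i\<in>UNIV. \<Sum>j\<in>UNIV. (x i - x j) \<bullet> (W i j *v (y i - y j))) =
      (\<Sum>i\<in>UNIV. \<Sum>j\<in>UNIV. f i j) + (\<Sum>i\<in>UNIV. \<Sum>j\<in>UNIV. g i j)"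
    by (simp add: f_def g_def inner_diff_left flip: sum.distrib)
  ultimately show ?thesis by simp
qed

lemma sym_psd_modal_lap: "sym_psd modal_lap"
proof -
  have "selfadjoint ((*v) modal_lap)"
    unfolding selfadjoint_def
  proof safe
    fix a b :: "real^('n \<times> 'q)"
    obtain x where a: "a = modal_vec v x" by (rule modal_vec_surj)
    obtain y where b: "b = modal_vec v y" by (rule modal_vec_surj)
    have "(x i - x j) \<bullet> (W i j *v (y i - y j)) = (y i - y j) \<bullet> (W i j *v (x i - x j))" for i j
      using selfadjoint_inner[OF sym_psd_selfadjoint[OF W(1)]] by (metis inner_commute)
    hence "a \<bullet> (modal_lap *v b) = b \<bullet> (modal_lap *v a)"
      unfolding a b modal_lap_form by simp
    thus "(modal_lap *v a) \<bullet> b = a \<bullet> (modal_lap *v b)" by (simp add: inner_commute)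
  qed simp
  moreover have "0 \<le> a \<bullet> (modal_lap *v a)" for a
  proof -
    obtain x where a: "a = modal_vec v x" by (rule modal_vec_surj)
    show ?thesis unfolding a modal_lap_form
      using W(1) by (auto simp: sym_psd_def intro!: sum_nonneg)
  qed
  ultimately show ?thesis by (simp add: sym_psd_def transpose_eq_of_selfadjoint)
qed

text \<open>A vector constant over the oscillators in one mode is a synchronous state, on which all
  differences vanish.\<close>

lemma modal_lap_emb_1: "modal_lap *v emb k 1 = 0"
proof -
  have "emb k 1 = modal_vec v (\<lambda>i::'q. v k)"
    by (simp add: emb_def modal_vec_def vec_eq_iff orthonormal)
  thus ?thesis by (simp add: modal_lap_apply) (simp add: modal_vec_def vec_eq_iff)
qed

lemma modal_block_1: "modal_block (lap W) v k l *v 1 = 0"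
  using blk_block_matrix_emb[of k "modal_block (lap W) v" l 1] by (simp add: modal_lap_emb_1 blk_simps)

text \<open>The off-diagonal entries of the diagonal blocks are \<open>- v\<^sub>k \<bullet> W\<^sub>i\<^sub>j v\<^sub>k\<close>. If they vanish, positive
  semidefiniteness puts every \<open>v\<^sub>k\<close> into the kernel of \<open>W\<^sub>i\<^sub>j\<close>. This provides a nonzero eigenvalue
  of some diagonal block, and so a nonempty set of gaps in the definition of \<^const>\<open>mu_bar\<close>.\<close>

lemma diagonal_blocks_zero_imp_uncoupled:
  assumes "\<And>k. modal_block (lap W) v k k = 0"
  shows "W i j = 0"
proof (cases "i = j")
  case False
  have "W i j *v v k = 0" for k
  proof (rule sym_psd_kernel[OF W(1)])
    have neg: "(- A) *v x = - (A *v x)" for A :: "real^'n^'n" and x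
      by (simp add: vec_eq_iff matrix_vector_mult_def sum_negf)
    have "modal_block (lap W) v k k $ i $ j = 0" by (simp add: assms)
    thus "v k \<bullet> (W i j *v v k) = 0" using False by (simp add: modal_block_entry lap_block_def neg)
  qed
  hence "W i j *v (\<Sum>k\<in>UNIV. (v k \<bullet> x) *\<^sub>R v k) = 0" for x
    by (simp add: linear_sum[OF matrix_vector_mul_linear] matrix_vector_mult_scaleR)
  thus ?thesis by (simp add: expansion matrix_eq)
qed (simp add: W)

end

end

text \<open>The orthogonal projection along the synchronous states: in each mode it removes the average over
  the oscillators.\<close>

definition center :: "real^('n::finite \<times> 'q::finite) \<Rightarrow> real^('n \<times> 'q)" where
  "center w = w - (\<Sum>k\<in>UNIV. ((1 \<bullet> blk k w) / real CARD('q)) *\<^sub>R emb k 1)"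

lemma blk_sum: "blk k (sum f S) = (\<Sum>x\<in>S. blk k (f x))"
  by (rule linear_sum[OF blk_linear])

lemma blk_center: "blk k (center w) = blk k w - ((1 \<bullet> blk k w) / real CARD('q)) *\<^sub>R 1"
  for w :: "real^('n::finite \<times> 'q::finite)"
proof -
  have "blk k (\<Sum>l\<in>UNIV. ((1 \<bullet> blk l w) / real CARD('q)) *\<^sub>R emb l 1) =
      (\<Sum>l\<in>UNIV. if l = k then ((1 \<bullet> blk k w) / real CARD('q)) *\<^sub>R 1 else 0)"
    unfolding blk_sum by (rule sum.cong) (auto simp: blk_simps blk_emb)
  thus ?thesis by (simp add: center_def blk_simps)
qed

lemma linear_center: "linear center"
proof (rule linearI; rule blk_eqI)
  fix x y :: "real^('n::finite \<times> 'q::finite)" and c k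
  show "blk k (center (x + y)) = blk k (center x + center y)"
    by (simp add: blk_center blk_simps inner_add_right add_divide_distrib scaleR_left_distrib)
  show "blk k (center (c *\<^sub>R x)) = blk k (c *\<^sub>R center x)"
    by (simp add: blk_center blk_simps scaleR_right_diff_distrib)
qed

lemma sum_blk_center:
  fixes w :: "real^('n::finite \<times> 'q::finite)"
  shows "(\<Sum>i\<in>UNIV. blk k (center w) $ i) = 0"
proof -
  have one: "(1::real^'q) \<bullet> 1 = real CARD('q)" by (simp add: inner_vec_def)
  show ?thesis unfolding sum_eq_inner_1 blk_center
    by (simp add: inner_diff_right one)
qed

lemma center_matrix:
  fixes A :: "real^('n::finite \<times> 'q::finite)^('n \<times> 'q)"
  assumes A: "selfadjoint ((*v) A)" "\<And>k. A *v emb k 1 = 0"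
  shows "center (A *v w) = A *v w" "A *v center w = A *v w"
proof -
  have "1 \<bullet> blk k (A *v w) = 0" for k
    using selfadjoint_inner[OF A(1), of "emb k 1" w] by (simp add: A(2) inner_emb)
  thus "center (A *v w) = A *v w" by (simp add: center_def)
  show "A *v center w = A *v w"
    by (simp add: center_def matrix_vector_mult_diff_distrib linear_sum[OF matrix_vector_mul_linear]
        matrix_vector_mult_scaleR A(2))
qed

lemma sum_components_axis: "(x::real^'a) = (\<Sum>a\<in>UNIV. (x $ a) *\<^sub>R axis a 1)"
  by (simp add: vec_eq_iff axis_def if_distrib[of "\<lambda>c. _ * c"] cong: if_cong)

lemma modal_vec_has_vector_derivative:
  fixes v :: "'n::finite \<Rightarrow> real^'n" and y :: "real \<Rightarrow> 'q::finite \<Rightarrow> real^'n"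
  assumes "\<And>i. ((\<lambda>t. y t i) has_vector_derivative y' i) F"
  shows "((\<lambda>t. modal_vec v (y t)) has_vector_derivative modal_vec v y') F"
proof -
  have eq: "modal_vec v u = (\<Sum>a\<in>UNIV. (v (fst a) \<bullet> u (snd a)) *\<^sub>R axis a 1)" for u :: "'q \<Rightarrow> real^'n"
    by (subst sum_components_axis) (simp add: modal_vec_def)
  have "linear (\<lambda>u. (v (fst a) \<bullet> u) *\<^sub>R axis a (1::real))" for a :: "'n \<times> 'q"
    by (rule linearI) (simp_all add: inner_add_right scaleR_left_distrib)
  thus ?thesis unfolding eq
    by (intro has_vector_derivative_sum) (rule linear_has_vector_derivative[OF _ assms])
qed

section \<open>Synchronization of the array\<close>

lemma modal_basis_of_distinct_eigenvalues:
  fixes P :: "real^'n^'n" and v :: "'n \<Rightarrow> real^'n"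
  assumes P: "selfadjoint ((*v) P)" and v: "\<And>k. P *v v k = \<sigma> k *\<^sub>R v k" "\<And>k. norm (v k) = 1"
    and \<sigma>: "inj \<sigma>"
  shows "modal_basis v"
proof
  show ortho: "v k \<bullet> v l = (if k = l then 1 else 0)" for k l
  proof (cases "k = l")
    case True
    thus ?thesis using v(2)[of l] by (simp add: dot_square_norm)
  next
    case False
    have "\<sigma> k * (v k \<bullet> v l) = (P *v v k) \<bullet> v l" by (simp add: v(1))
    also have "\<dots> = v k \<bullet> (P *v v l)" by (rule selfadjoint_inner[OF P])
    also have "\<dots> = \<sigma> l * (v k \<bullet> v l)" by (simp add: v(1))
    finally show ?thesis using False \<sigma> by (auto dest: injD)
  qed
  have inj: "inj v"
  proof (rule injI, rule ccontr)
    fix k l assume "v k = v l" "k \<noteq> l"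
    thus False using ortho[of k l] ortho[of l l] by simp
  qed
  have po: "pairwise orthogonal (range v)"
    by (auto simp: pairwise_def orthogonal_def ortho)
  have "0 \<notin> range v" using v(2) by (metis imageE norm_zero zero_neq_one)
  hence "independent (range v)" by (rule pairwise_orthogonal_independent[OF po])
  moreover have "card (range v) = DIM(real^'n)" using card_image[OF inj] by simp
  ultimately have "span (range v) = UNIV"
    using card_eq_dim[of "range v" UNIV] by (auto simp: dim_UNIV)
  hence "eigenbasis ((*v) P) (\<lambda>b. b \<bullet> (P *v b)) (range v)"
    using po v by (auto simp: eigenbasis_def ortho)
  from eigenbasis_expansion[OF this] have "(\<Sum>b\<in>range v. (x \<bullet> b) *\<^sub>R b) = x" for x .
  thus "(\<Sum>k\<in>UNIV. (v k \<bullet> x) *\<^sub>R v k) = x" for x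
    by (simp add: sum.reindex[OF inj] inner_commute o_def)
qed

lemma sym_psd_congruence:
  assumes N: "transpose N = N" and A: "sym_psd A"
  shows "sym_psd (N ** A ** N)"
proof -
  have At: "transpose A = A" using A by (simp add: sym_psd_def)
  have "0 \<le> x \<bullet> ((N ** A ** N) *v x)" for x
  proof -
    have "x \<bullet> ((N ** A ** N) *v x) = (N *v x) \<bullet> (A *v (N *v x))"
      using selfadjoint_inner[OF selfadjoint_matrix[OF N]] by (simp flip: matrix_vector_mul_assoc)
    thus ?thesis using A by (simp add: sym_psd_def)
  qed
  thus ?thesis by (simp add: sym_psd_def matrix_transpose_mul N At matrix_mul_assoc)
qed

lemma nonzero_eigenvalue_exists:
  fixes A :: "real^'n^'n"
  assumes "selfadjoint ((*v) A)" "A \<noteq> 0"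
  obtains x \<alpha> where "x \<noteq> 0" "A *v x = \<alpha> *\<^sub>R x" "\<alpha> \<noteq> 0"
proof -
  obtain S ev where S: "eigenbasis ((*v) A) ev S" by (rule selfadjoint_eigenbasis[OF assms(1)])
  have "\<exists>b\<in>S. ev b \<noteq> 0"
  proof (rule ccontr)
    assume "\<not> ?thesis"
    hence "A *v x = 0" for x using eigenbasis_apply[OF S, of x] by simp
    with assms(2) show False by (simp add: matrix_eq)
  qed
  then obtain b where b: "b \<in> S" "ev b \<noteq> 0" by blast
  show ?thesis by (rule that[of b "ev b"]) (use S b in \<open>auto simp: eigenbasis_def\<close>)
qed

text \<open>The substitution \<open>y = M\<^sup>1\<^sup>/\<^sup>2 x\<close>, followed by modal coordinates, turns the array into
  \<open>z'' + G z' + (\<Sigma> + \<epsilon> B) z = 0\<close> with the diagonal matrix \<open>\<Sigma>\<close> of the \<open>\<sigma>\<^sub>k\<close>. Both operators commute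
  with \<^const>\<open>center\<close>, so the disagreement part of \<open>z\<close> decays unless it supports an undamped
  eigenmode.\<close>

lemma synchronizes_if_no_undamped_mode:
  fixes M K :: "real^'n^'n" and D R :: "'q::finite \<Rightarrow> 'q \<Rightarrow> real^'n^'n"
  assumes M: "sym_pd M" and K: "sym_pd K"
    and D: "\<And>i j. sym_psd (D i j)" "\<And>i j. D i j = D j i" "\<And>i. D i i = 0"
    and R: "\<And>i j. sym_psd (R i j)" "\<And>i j. R i j = R j i" "\<And>i. R i i = 0"
    and v: "\<And>k. (inv_sqrt M ** K ** inv_sqrt M) *v v k = \<sigma> k *\<^sub>R v k" "\<And>k. norm (v k) = 1"
    and \<sigma>: "inj \<sigma>" and \<epsilon>: "\<epsilon> > 0"
  defines "G \<equiv> block_matrix (modal_block (lap (\<lambda>i j. inv_sqrt M ** D i j ** inv_sqrt M)) v)"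
    and "B \<equiv> block_matrix (modal_block (lap (\<lambda>i j. inv_sqrt M ** R i j ** inv_sqrt M)) v)"
  assumes no_mode: "\<And>w \<theta>. \<lbrakk>G *v w = 0; \<And>k. (\<Sum>i\<in>UNIV. blk k w $ i) = 0;
      \<And>k. \<sigma> k *\<^sub>R blk k w + \<epsilon> *\<^sub>R blk k (B *v w) = \<theta> *\<^sub>R blk k w\<rbrakk> \<Longrightarrow> w = 0"
  shows "synchronizes M K D R \<epsilon>"
  unfolding synchronizes_def
proof (intro allI impI)
  fix x i j assume sol: "array_solution M K D R \<epsilon> x"
  obtain S where S: "transpose S = S" "S ** S = M" "S ** inv_sqrt M = mat 1" "inv_sqrt M ** S = mat 1"
    and Nt: "transpose (inv_sqrt M) = inv_sqrt M"
    by (rule inv_sqrt_props[OF M])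
  define N where "N = inv_sqrt M"
  have SN: "S *v (N *v u) = u" "N *v (S *v u) = u" for u
    by (simp_all add: N_def S matrix_vector_mul_assoc)
  define P where "P = N ** K ** N"
  define Dt where "Dt i j = N ** D i j ** N" for i j
  define Rt where "Rt i j = N ** R i j ** N" for i j
  have Dt: "\<And>i j. sym_psd (Dt i j)" "\<And>i j. Dt i j = Dt j i" "\<And>i. Dt i i = 0"
    using D Nt by (auto simp: Dt_def N_def intro: sym_psd_congruence)
  have Rt: "\<And>i j. sym_psd (Rt i j)" "\<And>i j. Rt i j = Rt j i" "\<And>i. Rt i i = 0"
    using R Nt by (auto simp: Rt_def N_def intro: sym_psd_congruence)
  have Gdef: "G = block_matrix (modal_block (lap Dt) v)" and Bdef: "B = block_matrix (modal_block (lap Rt) v)"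
    by (simp_all add: G_def B_def Dt_def[abs_def] Rt_def[abs_def] N_def)
  note Kpsd = sym_pd_imp_sym_psd[OF K]
  have Psa: "selfadjoint ((*v) P)"
    unfolding P_def N_def by (rule sym_psd_selfadjoint[OF sym_psd_congruence[OF Nt Kpsd]])
  have vP: "P *v v k = \<sigma> k *\<^sub>R v k" for k using v(1) by (simp add: P_def N_def)
  interpret modal_basis v by (rule modal_basis_of_distinct_eigenvalues[OF Psa vP v(2) \<sigma>])
  have \<sigma>pos: "\<sigma> k > 0" for k
  proof -
    have "v k \<noteq> 0" using v(2)[of k] by auto
    hence "N *v v k \<noteq> 0" using SN(1)[of "v k"] by auto
    hence "0 < (N *v v k) \<bullet> (K *v (N *v v k))" using K by (simp add: sym_pd_def)
    also have "\<dots> = v k \<bullet> (P *v v k)"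
      using selfadjoint_inner[OF selfadjoint_matrix[OF Nt]] by (simp add: P_def N_def flip: matrix_vector_mul_assoc)
    also have "\<dots> = \<sigma> k" by (simp add: vP orthonormal)
    finally show ?thesis .
  qed
  have Gpsd: "sym_psd G" unfolding Gdef by (rule sym_psd_modal_lap[OF Dt])
  have Bpsd: "sym_psd B" unfolding Bdef by (rule sym_psd_modal_lap[OF Rt])
  note Gsa = sym_psd_selfadjoint[OF Gpsd] and Bsa = sym_psd_selfadjoint[OF Bpsd]
  have G1: "G *v emb k 1 = 0" for k unfolding Gdef by (rule modal_lap_emb_1[OF Dt])
  have B1: "B *v emb k 1 = 0" for k unfolding Bdef by (rule modal_lap_emb_1[OF Rt])

  define \<Sigma> :: "real^('n \<times> 'q) \<Rightarrow> real^('n \<times> 'q)" where "\<Sigma> w = (\<chi> a. \<sigma> (fst a) * w $ a)" for w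
  have blk\<Sigma>: "blk k (\<Sigma> w) = \<sigma> k *\<^sub>R blk k w" for k w
    by (simp add: \<Sigma>_def blk_def vec_eq_iff)
  define Q where "Q w = \<Sigma> w + \<epsilon> *\<^sub>R (B *v w)" for w
  have blkQ: "blk k (Q w) = \<sigma> k *\<^sub>R blk k w + \<epsilon> *\<^sub>R blk k (B *v w)" for k w
    by (simp add: Q_def blk_simps blk\<Sigma>)
  have Qsa: "selfadjoint Q"
    unfolding selfadjoint_def
  proof (intro conjI allI)
    show "linear Q"
      by (rule linearI)
         (simp_all add: Q_def \<Sigma>_def vec_eq_iff matrix_vector_right_distrib matrix_vector_mult_scaleR algebra_simps)
    show "Q a \<bullet> b = a \<bullet> Q b" for a b
    proof -
      have "\<Sigma> a \<bullet> b = a \<bullet> \<Sigma> b" by (simp add: inner_vec_def \<Sigma>_def mult_ac)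
      thus ?thesis by (simp add: Q_def inner_add_left inner_add_right selfadjoint_inner[OF Bsa])
    qed
  qed
  have Qpd: "0 < w \<bullet> Q w" if w: "w \<noteq> 0" for w
  proof -
    obtain a where a: "w $ a \<noteq> 0" using w by (metis vec_eq_iff zero_index)
    have "0 < (\<Sum>a\<in>UNIV. \<sigma> (fst a) * (w $ a)\<^sup>2)"
      by (rule sum_pos2[of _ a]) (use a \<sigma>pos in \<open>auto intro!: mult_nonneg_nonneg less_imp_le[OF \<sigma>pos]\<close>)
    also have "\<dots> = w \<bullet> \<Sigma> w" by (simp add: inner_vec_def \<Sigma>_def power2_eq_square mult_ac)
    finally have "0 < w \<bullet> \<Sigma> w" .
    moreover have "0 \<le> w \<bullet> (B *v w)" using Bpsd by (simp add: sym_psd_def)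
    ultimately show ?thesis using \<epsilon> by (simp add: Q_def inner_add_right add_pos_nonneg)
  qed
  have Gnn: "0 \<le> w \<bullet> (G *v w)" for w using Gpsd by (simp add: sym_psd_def)

  obtain x' x'' where d: "\<And>i t. t \<ge> 0 \<Longrightarrow> (x i has_vector_derivative x' i t) (at t within {0..})"
      "\<And>i t. t \<ge> 0 \<Longrightarrow> (x' i has_vector_derivative x'' i t) (at t within {0..})"
    and eq: "\<And>i t. t \<ge> 0 \<Longrightarrow> M *v x'' i t + K *v x i t + (\<Sum>j\<in>UNIV. D i j *v (x' i t - x' j t))
          + \<epsilon> *\<^sub>R (\<Sum>j\<in>UNIV. R i j *v (x i t - x j t)) = 0"
    using sol unfolding array_solution_def by blast
  define z where "z t = modal_vec v (\<lambda>i. S *v x i t)" for t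
  define z' where "z' t = modal_vec v (\<lambda>i. S *v x' i t)" for t
  have zsol: "damped_solution Q ((*v) G) z z'"
    unfolding damped_solution_def
  proof (intro allI impI conjI)
    fix t :: real assume t: "t \<ge> 0"
    show "(z has_vector_derivative z' t) (at t within {0..})"
      unfolding z_def z'_def
      by (intro modal_vec_has_vector_derivative linear_has_vector_derivative[OF matrix_vector_mul_linear] d(1) t)
    have "(z' has_vector_derivative modal_vec v (\<lambda>i. S *v x'' i t)) (at t within {0..})"
      unfolding z'_def
      by (intro modal_vec_has_vector_derivative linear_has_vector_derivative[OF matrix_vector_mul_linear] d(2) t)
    moreover have "modal_vec v (\<lambda>i. S *v x'' i t) = - Q (z t) - G *v z' t"
    proof -
      have S'': "S *v x'' i t = - (P *v (S *v x i t)) - (\<Sum>j\<in>UNIV. Dt i j *v (S *v x' i t - S *v x' j t))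
          - \<epsilon> *\<^sub>R (\<Sum>j\<in>UNIV. Rt i j *v (S *v x i t - S *v x j t))" for i
      proof -
        have "N *v (M *v x'' i t + K *v x i t + (\<Sum>j\<in>UNIV. D i j *v (x' i t - x' j t))
          + \<epsilon> *\<^sub>R (\<Sum>j\<in>UNIV. R i j *v (x i t - x j t))) = 0" by (simp add: eq[OF t])
        moreover have "N *v (M *v x'' i t) = S *v x'' i t"
          using SN(2)[of "S *v x'' i t"] by (simp flip: S(2) matrix_vector_mul_assoc)
        moreover have "N *v (K *v x i t) = P *v (S *v x i t)"
          by (simp add: P_def SN flip: matrix_vector_mul_assoc)
        moreover have "N *v (\<Sum>j\<in>UNIV. D i j *v (x' i t - x' j t)) = (\<Sum>j\<in>UNIV. Dt i j *v (S *v x' i t - S *v x' j t))"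
          by (simp add: linear_sum[OF matrix_vector_mul_linear] Dt_def SN
              flip: matrix_vector_mul_assoc matrix_vector_mult_diff_distrib)
        moreover have "N *v (\<Sum>j\<in>UNIV. R i j *v (x i t - x j t)) = (\<Sum>j\<in>UNIV. Rt i j *v (S *v x i t - S *v x j t))"
          by (simp add: linear_sum[OF matrix_vector_mul_linear] Rt_def SN
              flip: matrix_vector_mul_assoc matrix_vector_mult_diff_distrib)
        ultimately have "S *v x'' i t + P *v (S *v x i t) + (\<Sum>j\<in>UNIV. Dt i j *v (S *v x' i t - S *v x' j t))
          + \<epsilon> *\<^sub>R (\<Sum>j\<in>UNIV. Rt i j *v (S *v x i t - S *v x j t)) = 0"
          by (simp add: matrix_vector_right_distrib matrix_vector_mult_scaleR)
        thus ?thesis by (simp add: algebra_simps eq_neg_iff_add_eq_0)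
      qed
      have "v k \<bullet> (P *v u) = \<sigma> k * (v k \<bullet> u)" for k u
        using selfadjoint_inner[OF Psa, of "v k" u] by (simp add: vP)
      hence "modal_vec v (\<lambda>i. S *v x'' i t) = - \<Sigma> (z t)
          - modal_vec v (\<lambda>i. \<Sum>j\<in>UNIV. Dt i j *v (S *v x' i t - S *v x' j t))
          - \<epsilon> *\<^sub>R modal_vec v (\<lambda>i. \<Sum>j\<in>UNIV. Rt i j *v (S *v x i t - S *v x j t))"
        unfolding S'' by (simp add: modal_vec_def \<Sigma>_def z_def vec_eq_iff inner_diff_right)
      also have "\<dots> = - \<Sigma> (z t) - G *v z' t - \<epsilon> *\<^sub>R (B *v z t)"
        by (simp add: Gdef Bdef z_def z'_def modal_lap_apply[OF Dt] modal_lap_apply[OF Rt])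
      finally show ?thesis by (simp add: Q_def)
    qed
    ultimately show "(z' has_vector_derivative - Q (z t) - G *v z' t) (at t within {0..})" by simp
  qed
  have lim: "((\<lambda>t. center (z t)) \<longlongrightarrow> 0) at_top"
  proof (rule damped_solution_decay[OF Qsa _ Gsa Gnn zsol])
    show "0 < w \<bullet> Q w" if "w \<noteq> 0" for w by (rule Qpd[OF that])
    show "linear (center :: real^('n \<times> 'q) \<Rightarrow> _)" by (rule linear_center)
    show "center (Q w) = Q (center w)" for w
    proof -
      have "center (\<Sigma> w) = \<Sigma> (center w)"
        by (rule blk_eqI) (simp add: blk_center blk\<Sigma> scaleR_right_diff_distrib)
      thus ?thesis
        by (simp add: Q_def linear_add[OF linear_center] linear_scale[OF linear_center] center_matrix[OF Bsa B1])
    qed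
    show "center (G *v w) = G *v center w" for w by (simp add: center_matrix[OF Gsa G1])
    fix w \<theta> assume w: "w \<in> range center" "G *v w = 0" "Q w = \<theta> *\<^sub>R w"
    show "w = 0"
    proof (rule no_mode[OF w(2)])
      show "(\<Sum>i\<in>UNIV. blk k w $ i) = 0" for k using w(1) by (auto simp: sum_blk_center)
      show "\<sigma> k *\<^sub>R blk k w + \<epsilon> *\<^sub>R blk k (B *v w) = \<theta> *\<^sub>R blk k w" for k
        using w(3) by (simp flip: blkQ add: blk_simps)
    qed
  qed
  have coord: "((\<lambda>t. v k \<bullet> (S *v x i t - S *v x j t)) \<longlongrightarrow> 0) at_top" for k
  proof -
    have "v k \<bullet> (S *v x i t - S *v x j t) = center (z t) $ (k, i) - center (z t) $ (k, j)" for t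
    proof -
      have "center (z t) $ (k, l) = blk k (center (z t)) $ l" for l by (simp add: blk_def)
      hence "center (z t) $ (k, l) = v k \<bullet> (S *v x l t) - (1 \<bullet> blk k (z t)) / real CARD('q)" for l
        by (simp add: blk_center) (simp add: blk_def z_def modal_vec_def)
      thus ?thesis by (simp add: inner_diff_right)
    qed
    moreover have "((\<lambda>t. center (z t) $ (k, i) - center (z t) $ (k, j)) \<longlongrightarrow> 0) at_top"
      using tendsto_diff[OF tendsto_vec_nth[OF lim, of "(k, i)"] tendsto_vec_nth[OF lim, of "(k, j)"]] by simp
    ultimately show ?thesis by simp
  qed
  have "((\<lambda>t. \<Sum>k\<in>UNIV. (v k \<bullet> (S *v x i t - S *v x j t)) *\<^sub>R v k) \<longlongrightarrow> (\<Sum>k\<in>UNIV. 0 *\<^sub>R v k)) at_top"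
    by (intro tendsto_sum tendsto_scaleR coord tendsto_const)
  hence "((\<lambda>t. S *v x i t - S *v x j t) \<longlongrightarrow> 0) at_top" by (simp add: expansion)
  hence "((\<lambda>t. N *v (S *v x i t - S *v x j t)) \<longlongrightarrow> 0) at_top"
    by (rule bounded_linear.tendsto_zero[OF matrix_vector_mul_bounded_linear])
  hence "((\<lambda>t. x i t - x j t) \<longlongrightarrow> 0) at_top"
    by (simp add: matrix_vector_mult_diff_distrib SN)
  thus "((\<lambda>t. norm (x i t - x j t)) \<longlongrightarrow> 0) at_top" by (rule tendsto_norm_zero)
qed

theorem theorem2:
  fixes M K P :: "real^'n^'n"
    and D R :: "'q::finite \<Rightarrow> 'q \<Rightarrow> real^'n^'n"
    and \<sigma> :: "'n \<Rightarrow> real" and v :: "'n \<Rightarrow> real^'n"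
    and Ld Lr :: "real^('q \<times> 'n)^('q \<times> 'n)"
    and Gb Bb :: "'n \<Rightarrow> 'n \<Rightarrow> real^'q^'q"
    and G B :: "real^('n \<times> 'q)^('n \<times> 'q)"
  assumes "sym_pd M" and "sym_pd K"
    and "\<And>i j. sym_psd (D i j)" and "\<And>i j. D i j = D j i" and "\<And>i. D i i = 0"
    and "\<And>i j. sym_psd (R i j)" and "\<And>i j. R i j = R j i" and "\<And>i. R i i = 0"
    and "\<exists>i j. R i j \<noteq> 0"
    and "P = inv_sqrt M ** K ** inv_sqrt M"
    and "\<And>k. P *v v k = \<sigma> k *\<^sub>R v k" and "\<And>k. norm (v k) = 1" and "inj \<sigma>"
    and "Ld = lap (\<lambda>i j. inv_sqrt M ** D i j ** inv_sqrt M)"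
    and "Lr = lap (\<lambda>i j. inv_sqrt M ** R i j ** inv_sqrt M)"
    and "\<And>k l. Gb k l = modal_block Ld v k l" and "\<And>k l. Bb k l = modal_block Lr v k l"
    and "G = block_matrix Gb" and "B = block_matrix Bb"
    and "\<And>k. Re (eigenval 2 (complex_matrix (Gb k k) (Bb k k))) > 0"
  shows "(\<exists>r>0. \<forall>\<epsilon>\<in>{0<..<r}. synchronizes M K D R \<epsilon>) \<and>
    (CARD('n) \<ge> 2 \<longrightarrow>
      (let \<gamma> = gamma_bar (\<lambda>k. Gb k k) (\<lambda>k. Bb k k);
           \<mu> = mu_bar (\<lambda>k. Bb k k);
           r = \<gamma> * sigma_bar \<sigma> * \<mu> /
                 ((sqrt (matrix_norm G) + 2 * \<gamma>) * sqrt (real CARD('n) - 1) * matrix_norm B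
                    * (\<mu> + matrix_norm B))
       in r > 0 \<and> (\<forall>\<epsilon>\<in>{0<..<r}. synchronizes M K D R \<epsilon>)))"
proof -
  note M = assms(1) and K = assms(2) and D = assms(3-5) and R = assms(6-8) and R_nz = assms(9)
    and v = assms(11)[unfolded assms(10)] and v1 = assms(12) and \<sigma> = assms(13) and pos = assms(20)
  obtain S where S: "S ** inv_sqrt M = mat 1" "inv_sqrt M ** S = mat 1"
    and Nt: "transpose (inv_sqrt M) = inv_sqrt M"
    by (rule inv_sqrt_props[OF M])
  define Dt where "Dt i j = inv_sqrt M ** D i j ** inv_sqrt M" for i j
  define Rt where "Rt i j = inv_sqrt M ** R i j ** inv_sqrt M" for i j
  have Dt: "\<And>i j. sym_psd (Dt i j)" "\<And>i j. Dt i j = Dt j i" "\<And>i. Dt i i = 0"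
    using D Nt by (auto simp: Dt_def intro: sym_psd_congruence)
  have Rt: "\<And>i j. sym_psd (Rt i j)" "\<And>i j. Rt i j = Rt j i" "\<And>i. Rt i i = 0"
    using R Nt by (auto simp: Rt_def intro: sym_psd_congruence)
  have Gb: "Gb = modal_block (lap Dt) v" and Bb: "Bb = modal_block (lap Rt) v"
    using assms(14-17) by (auto simp: fun_eq_iff Dt_def[abs_def] Rt_def[abs_def])
  note Kpsd = sym_pd_imp_sym_psd[OF K]
  interpret modal_basis v
    by (rule modal_basis_of_distinct_eigenvalues[OF sym_psd_selfadjoint[OF sym_psd_congruence[OF Nt Kpsd]] v v1 \<sigma>])
  have Gpsd: "sym_psd (block_matrix Gb)" unfolding Gb by (rule sym_psd_modal_lap[OF Dt])
  have Bpsd: "sym_psd (block_matrix Bb)" unfolding Bb by (rule sym_psd_modal_lap[OF Rt])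
  have G1: "Gb k k *v 1 = 0" for k unfolding Gb by (rule modal_block_1[OF Dt])
  have B1: "Bb k k *v 1 = 0" for k unfolding Bb by (rule modal_block_1[OF Rt])
  have Bsa: "selfadjoint ((*v) (Bb k k))" for k
    by (rule selfadjoint_diagonal_block[OF sym_psd_selfadjoint[OF Bpsd]])

  obtain i j where ij: "R i j \<noteq> 0" using R_nz by blast
  hence "i \<noteq> j" using R(3) by auto
  hence q: "CARD('q) \<ge> 2"
    using card_mono[of UNIV "{i, j}"] by simp
  have "Rt i j \<noteq> 0"
  proof
    assume "Rt i j = 0"
    hence "S ** Rt i j ** S = 0" by simp
    moreover have "S ** Rt i j ** S = (S ** inv_sqrt M) ** R i j ** (inv_sqrt M ** S)"
      by (simp only: Rt_def matrix_mul_assoc)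
    ultimately show False using ij by (simp add: S)
  qed
  have "\<exists>k. Bb k k \<noteq> 0"
  proof (rule ccontr)
    assume "\<not> ?thesis"
    hence "modal_block (lap Rt) v k k = 0" for k by (simp add: Bb)
    from diagonal_blocks_zero_imp_uncoupled[OF Rt this] \<open>Rt i j \<noteq> 0\<close> show False by blast
  qed
  then obtain k where k: "Bb k k \<noteq> 0" by blast
  obtain e \<alpha> where e: "e \<noteq> 0" "Bb k k *v e = \<alpha> *\<^sub>R e" "\<alpha> \<noteq> 0"
    by (rule nonzero_eigenvalue_exists[OF Bsa k])

  define \<gamma> where "\<gamma> = gamma_bar (\<lambda>k. Gb k k) (\<lambda>k. Bb k k)"
  define \<mu> where "\<mu> = mu_bar (\<lambda>k. Bb k k)"
  define g where "g = matrix_norm G"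
  define b where "b = matrix_norm B"
  have \<gamma>pos: "\<gamma> > 0"
    unfolding \<gamma>_def by (rule gamma_bar_pos[OF q sym_psd_diagonal_block[OF Gpsd] G1 Bsa B1 pos])
  have \<gamma>le: "\<gamma>\<^sup>2 * (norm u)\<^sup>2 \<le> u \<bullet> (Gb k k *v u)"
    if "Bb k k *v u = \<alpha> *\<^sub>R u" "(\<Sum>i\<in>UNIV. u $ i) = 0" for k u \<alpha>
    unfolding \<gamma>_def
    by (rule gamma_bar_le[where G="\<lambda>k. Gb k k" and B="\<lambda>k. Bb k k" and \<mu>=\<alpha>])
       (simp_all add: q sym_psd_diagonal_block[OF Gpsd] G1 Bsa B1 pos that)
  \<comment> \<open>The eigenvalue 0 of the all-ones vector and \<open>\<alpha>\<close> provide a gap, so that the minimum is over a nonempty set.\<close>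
  have \<mu>pos: "\<mu> > 0"
    unfolding \<mu>_def by (rule mu_bar_pos[of e 1 _ k \<alpha> 0]) (use e B1 in auto)
  have \<mu>gap: "2 * \<mu> \<le> \<bar>\<alpha> - \<beta>\<bar>"
    if "x \<noteq> 0" "y \<noteq> 0" "Bb k k *v x = \<alpha> *\<^sub>R x" "Bb k k *v y = \<beta> *\<^sub>R y" "\<alpha> \<noteq> \<beta>" for k x y \<alpha> \<beta>
    unfolding \<mu>_def by (rule mu_bar_gap[of x y _ k]) (use that in auto)
  have g0: "g \<ge> 0" by (simp add: g_def matrix_norm_nonneg)
  \<comment> \<open>Otherwise \<open>B\<close> would annihilate the vector that carries \<open>e\<close> in block \<open>k\<close>.\<close>
  have b0: "b > 0"
  proof (rule ccontr)
    assume "\<not> b > 0"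
    hence "norm (B *v emb k e) \<le> 0"
      using matrix_norm_le[of B "emb k e"] matrix_norm_nonneg[of B] by (simp add: b_def)
    hence "blk k (B *v emb k e) = 0" by (simp add: blk_simps)
    thus False using e by (simp add: assms(19) blk_block_matrix_emb)
  qed

  \<comment> \<open>The condition on \<open>\<epsilon>\<close> follows from \<open>\<epsilon> < r\<close>, whose denominator has \<open>2 \<gamma>\<close> for \<open>\<gamma>\<close> and the extra factor \<open>sqrt (n - 1) \<ge> 1\<close>.\<close>
  have sync: "synchronizes M K D R \<epsilon>"
    if \<epsilon>: "\<epsilon> > 0" "(sqrt g + \<gamma>) * (\<epsilon> * b * (\<mu> + b)) < \<gamma> * (s * \<mu>)"
      and s: "s > 0" "\<And>k l. k \<noteq> l \<Longrightarrow> 2 * s \<le> \<bar>\<sigma> k - \<sigma> l\<bar>" for s \<epsilon>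
  proof (rule synchronizes_if_no_undamped_mode[OF M K D R v v1 \<sigma> \<epsilon>(1)])
    fix w \<theta>
    assume "block_matrix (modal_block (lap (\<lambda>i j. inv_sqrt M ** D i j ** inv_sqrt M)) v) *v w = 0"
      and w0: "\<And>k. (\<Sum>i\<in>UNIV. blk k w $ i) = 0"
      and "\<And>k. \<sigma> k *\<^sub>R blk k w + \<epsilon> *\<^sub>R blk k
        (block_matrix (modal_block (lap (\<lambda>i j. inv_sqrt M ** R i j ** inv_sqrt M)) v) *v w) = \<theta> *\<^sub>R blk k w"
    hence w: "block_matrix Gb *v w = 0"
      "\<And>k. \<sigma> k *\<^sub>R blk k w + \<epsilon> *\<^sub>R blk k (block_matrix Bb *v w) = \<theta> *\<^sub>R blk k w"
      by (simp_all add: Gb Bb Dt_def[abs_def] Rt_def[abs_def])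
    have \<epsilon>2: "(sqrt (matrix_norm (block_matrix Gb)) + \<gamma>) *
        (\<epsilon> * matrix_norm (block_matrix Bb) * (\<mu> + matrix_norm (block_matrix Bb))) < \<gamma> * (s * \<mu>)"
      using \<epsilon>(2) by (simp add: g_def b_def assms(18,19))
    show "w = 0"
    proof (rule undamped_mode_vanishes[where \<sigma>=\<sigma> and \<theta>=\<theta> and \<epsilon>=\<epsilon> and \<mu>=\<mu> and \<gamma>=\<gamma> and s=s,
            OF Gpsd sym_psd_selfadjoint[OF Bpsd] B1 s(1) _ \<mu>pos _ \<gamma>pos _ \<epsilon>(1) \<epsilon>2 w(1) w0 w(2)])
      show "2 * s \<le> \<bar>\<sigma> k - \<sigma> l\<bar>" if "k \<noteq> l" for k l by (rule s(2)[OF that])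
      show "2 * \<mu> \<le> \<bar>\<alpha> - \<beta>\<bar>"
        if "x \<noteq> 0" "y \<noteq> 0" "Bb k k *v x = \<alpha> *\<^sub>R x" "Bb k k *v y = \<beta> *\<^sub>R y" "\<alpha> \<noteq> \<beta>" for k x y \<alpha> \<beta>
        by (rule \<mu>gap[OF that])
      show "\<gamma>\<^sup>2 * (norm u)\<^sup>2 \<le> u \<bullet> (Gb k k *v u)"
        if "Bb k k *v u = \<alpha> *\<^sub>R u" "(\<Sum>i\<in>UNIV. u $ i) = 0" for k u \<alpha>
        by (rule \<gamma>le[OF that])
    qed
  qed

  define r where "r = \<gamma> * sigma_bar \<sigma> * \<mu> / ((sqrt g + 2 * \<gamma>) * sqrt (real CARD('n) - 1) * b * (\<mu> + b))"
  have big: "r > 0 \<and> (\<forall>\<epsilon>\<in>{0<..<r}. synchronizes M K D R \<epsilon>)" if n: "CARD('n) \<ge> 2"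
  proof (intro conjI ballI)
    have sb: "sigma_bar \<sigma> > 0" by (rule sigma_bar_pos[OF \<sigma> n])
    have root: "1 \<le> sqrt (real CARD('n) - 1)" using n by simp
    define X where "X = (sqrt g + 2 * \<gamma>) * sqrt (real CARD('n) - 1) * b * (\<mu> + b)"
    have X: "X > 0" unfolding X_def using g0 \<gamma>pos \<mu>pos b0 root
      by (intro mult_pos_pos add_nonneg_pos) auto
    show "r > 0" unfolding r_def X_def[symmetric] using X sb \<gamma>pos \<mu>pos by simp
    fix \<epsilon> assume "\<epsilon> \<in> {0<..<r}"
    hence \<epsilon>: "\<epsilon> > 0" "\<epsilon> * X < \<gamma> * sigma_bar \<sigma> * \<mu>"
      using X by (auto simp: r_def X_def[symmetric] pos_less_divide_eq)
    have "(sqrt g + \<gamma>) * (\<epsilon> * b * (\<mu> + b)) \<le> ((sqrt g + 2 * \<gamma>) * sqrt (real CARD('n) - 1)) * (\<epsilon> * b * (\<mu> + b))"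
    proof (rule mult_right_mono)
      have "sqrt g + \<gamma> \<le> (sqrt g + 2 * \<gamma>) * 1" using \<gamma>pos by simp
      also have "\<dots> \<le> (sqrt g + 2 * \<gamma>) * sqrt (real CARD('n) - 1)"
        by (rule mult_left_mono[OF root]) (use g0 \<gamma>pos in simp)
      finally show "sqrt g + \<gamma> \<le> (sqrt g + 2 * \<gamma>) * sqrt (real CARD('n) - 1)" .
    qed (use \<epsilon>(1) b0 \<mu>pos in simp)
    also have "\<dots> = \<epsilon> * X" by (simp add: X_def mult_ac)
    also have "\<dots> < \<gamma> * (sigma_bar \<sigma> * \<mu>)" using \<epsilon>(2) by (simp add: mult_ac)
    finally show "synchronizes M K D R \<epsilon>"
      by (rule sync[OF \<epsilon>(1) _ sb sigma_bar_gap])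
  qed
  moreover have "\<exists>r>0. \<forall>\<epsilon>\<in>{0<..<r}. synchronizes M K D R \<epsilon>"
  proof (cases "CARD('n) \<ge> 2")
    case True
    with big show ?thesis by blast
  next
    case False
    have single: "k = l" for k l :: 'n
      using False card_le_Suc0_iff_eq[of "UNIV::'n set"] by simp
    \<comment> \<open>With a single mode no block has to be separated from another, and any \<open>s\<close> will do; \<open>s = 1\<close> is taken.\<close>
    define X where "X = (sqrt g + \<gamma>) * (b * (\<mu> + b))"
    have X: "X > 0" unfolding X_def using g0 \<gamma>pos \<mu>pos b0
      by (intro mult_pos_pos add_nonneg_pos) auto
    show ?thesis
    proof (intro exI[of _ "\<gamma> * \<mu> / X"] conjI ballI)
      show "\<gamma> * \<mu> / X > 0" using X \<gamma>pos \<mu>pos by simp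
      fix \<epsilon> assume "\<epsilon> \<in> {0<..<\<gamma> * \<mu> / X}"
      hence \<epsilon>: "\<epsilon> > 0" "\<epsilon> * X < \<gamma> * \<mu>" using X by (auto simp: pos_less_divide_eq)
      show "synchronizes M K D R \<epsilon>"
        by (rule sync[OF \<epsilon>(1), of 1]) (use \<epsilon>(2) single in \<open>auto simp: X_def mult_ac\<close>)
    qed
  qed
  ultimately show ?thesis
    by (simp add: Let_def r_def \<gamma>_def \<mu>_def g_def b_def)
qed

end
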